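(* Let $1\le r\le m$ and $n\ge1$ be integers, let $h>0$, $t_j=t_0+jh$ for $j=0,\ldots,n$, and let $\mathcal{Y}_0,\ldots,\mathcal{Y}_n\in \mathrm{Gr}(r,m)$ be data at these nodes. Let $q\in\mathrm{Gr}(r,m)$ be a reference subspace and suppose that $$\max_{0\le j\le n} d_{\mathrm{Gr}}(q,\mathcal{Y}_j)\le A h$$ for some constant $A$ independent of $h$. Let $$\Lambda_n=\max_{1\le k\le n}\max_{0\le j\le n-k}\sup_{t\in[t_0,t_n]}\bigl|\lambda_j^k(t)\bigr|,\qquad \lambda_j^k(t)=\frac{t-t_j}{t_{j+k}-t_j},$$ and set $C_0=A$, $C_k=(1+2\Lambda_n)C_{k-1}$ for $k=1,\ldots,n$. If $$2C_{n-1}h<\frac{\pi}{2},$$ then in the $\mathrm{GIDER}_n$ recursion (evaluated at any $t\in[t_0,t_n]$) every pair of intermediate subspaces appearing as the two arguments of a $\mathrm{GLERP}$ step is connected by a unique minimizing geodesic. More precisely, every level-$k$ intermediate subspace satisfies $$d_{\mathrm{Gr}}\bigl(q,\mathcal{I}_j^k(t)\bigr)\le C_k h,\qquad k=0,1,\ldots,n,$$ and every pair used in a level-$k$ recursive step ($1\le k\le n$, $0\le j\le n-k$) satisfies $$\theta_{\max}\bigl(\mathcal{I}_j^{k-1}(t),\mathcal{I}_{j+1}^{k-1}(t)\bigr)\le d_{\mathrm{Gr}}\bigl(\mathcal{I}_j^{k-1}(t),\mathcal{I}_{j+1}^{k-1}(t)\bigr)\le 2C_{k-1}h\le 2C_{n-1}h,$$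 where $\theta_{\max}$ denotes the largest principal angle. Consequently, if $\eta<\pi/2$ and $2C_{n-1}h\le\eta$, then all principal angles between the pairs of subspaces used as arguments of the $\mathrm{GLERP}$ steps are at least $\pi/2-\eta$ away from the cut-locus threshold $\pi/2$ (i.e. are at most $\eta$).
   Context: $\mathrm{Gr}(r,m)$ is the Grassmann manifold of $r$-dimensional linear subspaces of $\mathbb{R}^m$. A point $\mathcal{Y}$ is represented by $Y\in\mathbb{R}^{m\times r}$ with $Y^TY=I_r$ and $\mathcal{Y}=\mathrm{span}(Y)$ (column span); $Y$ and $YR$, $R\in O(r)$, represent the same point. The tangent space is identified with $\{\Delta\in\mathbb{R}^{m\times r}:Y^T\Delta=0\}$, with the canonical Riemannian metric $\langle\Delta_1,\Delta_2\rangle=\mathrm{tr}(\Delta_1^T\Delta_2)$. The principal angles $\theta_1,\ldots,\theta_r\in[0,\pi/2]$ between $\mathrm{span}(Y_0)$ and $\mathrm{span}(Y_1)$ are defined by the requirement that $\cos\theta_j$ are the singular values of $Y_0^TY_1$, and the geodesic distance is $d_{\mathrm{Gr}}=(\sum_j\theta_j^2)^{1/2}$. Exponential map: if $\Delta=U\Theta V^T$ is a thin SVD ($V\in O(r)$), then $\mathrm{Exp}_{\mathcal{Y}}(\Delta)=\mathrm{span}(YV\cos\Theta+U\sin\Theta)$. Logarithm map: when all principal angles between $\mathcal{Y}_0=\mathrm{span}(Y_0)$ and $\mathcal{Y}_1=\mathrm{span}(Y_1)$ are $<\pi/2$ (equivalently $Y_0^TY_1$ is invertible), $\mathrm{Log}_{\mathcal{Y}_0}(\mathcal{Y}_1)=U\arctan(\Sigma)V^T$,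 where $Y_1(Y_0^TY_1)^{-1}-Y_0=U\Sigma V^T$ is an SVD. $\mathrm{GLERP}(\mathcal{A},\mathcal{B};\lambda)=\mathrm{Exp}_{\mathcal{A}}\bigl(\lambda\,\mathrm{Log}_{\mathcal{A}}(\mathcal{B})\bigr)$, used for all real $\lambda$ (including $\lambda\notin[0,1]$) whenever the logarithm is uniquely defined. $\mathrm{GIDER}_n$ recursion: given $\mathcal{Y}_0,\ldots,\mathcal{Y}_n$ at nodes $t_j=t_0+jh$, set $\mathcal{I}_j^0(t)=\mathcal{Y}_j$ and for $k=1,\ldots,n$, $j=0,\ldots,n-k$, $$\mathcal{I}_j^k(t)=\mathrm{GLERP}\bigl(\mathcal{I}_j^{k-1}(t),\mathcal{I}_{j+1}^{k-1}(t);\lambda_j^k(t)\bigr).$$ Then $\mathrm{GIDER}_n(\mathcal{Y}_0,\ldots,\mathcal{Y}_n;t)=\mathcal{I}_0^n(t)$ for $t\in[t_0,t_n]$. The subspaces $\mathcal{I}_j^k(t)$ are called the level-$k$ intermediate subspaces. *)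

theory Defs
  imports "HOL-Analysis.Analysis" "HOL-Library.Multiset"
begin

text \<open>
  The ambient dimension is \<open>m = CARD('m)\<close> and the subspace dimension is \<open>r = CARD('r)\<close>; an
  \<open>m \<times> r\<close> matrix has type \<open>real^'r^'m\<close>. Points of the Grassmannian are sets of vectors, whose type
  does not mention \<open>'r\<close>, so several constants take an argument \<open>TYPE('r)\<close>.
\<close>

definition diag_mat :: "real^'r \<Rightarrow> real^'r^'r::finite" where
  "diag_mat s = (\<chi> i j. if i = j then s $ i else 0)"

definition thin_svd :: "real^'r^'m \<Rightarrow> real^'r^'m \<Rightarrow> real^'r \<Rightarrow> real^'r^'r \<Rightarrow> bool" where
  "thin_svd M U s V \<longleftrightarrow>
     transpose U ** U = mat 1 \<and> orthogonal_matrix V \<and> (\<forall>i. 0 \<le> s $ i) \<and>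
     M = U ** diag_mat s ** transpose V"

definition Gr :: "'r::finite itself \<Rightarrow> (real^'m) set set" where
  "Gr (R :: 'r itself) = {S. subspace S \<and> dim S = CARD('r)}"

definition represents :: "real^'r^'m \<Rightarrow> (real^'m) set \<Rightarrow> bool" where
  "represents Y S \<longleftrightarrow> transpose Y ** Y = mat 1 \<and> span (columns Y) = S"

text \<open>
  The principal angles form a multiset with \<open>r\<close> elements. For two points of the Grassmannian it does
  not depend on the representatives or on the singular value decomposition.
\<close>

definition principal_angles ::
  "'r::finite itself \<Rightarrow> (real^'m) set \<Rightarrow> (real^'m) set \<Rightarrow> real multiset" where
  "principal_angles (R :: 'r itself) A B =
     (THE T. \<exists>(Y0 :: real^'r^'m) (Y1 :: real^'r^'m) U \<theta> V.
        represents Y0 A \<and> represents Y1 B \<and>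
        (\<forall>i. 0 \<le> \<theta> $ i \<and> \<theta> $ i \<le> pi / 2) \<and>
        thin_svd (transpose Y0 ** Y1) U (\<chi> i. cos (\<theta> $ i)) V \<and>
        T = image_mset (\<lambda>i. \<theta> $ i) (mset_set UNIV))"

definition dist_Gr :: "'r::finite itself \<Rightarrow> (real^'m) set \<Rightarrow> (real^'m) set \<Rightarrow> real" where
  "dist_Gr R A B = sqrt (\<Sum>\<theta>\<in>#principal_angles R A B. \<theta>\<^sup>2)"

definition max_angle :: "'r::finite itself \<Rightarrow> (real^'m) set \<Rightarrow> (real^'m) set \<Rightarrow> real" where
  "max_angle R A B = Max (set_mset (principal_angles R A B))"

text \<open>
  Tangent vectors at \<open>span (columns Y)\<close> are expressed relative to the representative \<open>Y\<close>: passing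
  from \<open>Y\<close> to \<open>Y ** Q\<close> with \<open>Q\<close> orthogonal turns \<open>\<Delta>\<close> into \<open>\<Delta> ** Q\<close>. Hence the exponential and
  the logarithm take the representative of the base point as an argument.
\<close>

definition Exp_Gr :: "real^'r^'m \<Rightarrow> real^'r^'m \<Rightarrow> (real^'m) set" where
  "Exp_Gr Y \<Delta> =
     (THE S. \<exists>U \<theta> V. thin_svd \<Delta> U \<theta> V \<and>
        S = span (columns (Y ** V ** diag_mat (\<chi> i. cos (\<theta> $ i)) +
                           U ** diag_mat (\<chi> i. sin (\<theta> $ i)))))"

definition Log_Gr :: "real^'r^'m \<Rightarrow> (real^'m) set \<Rightarrow> real^'r^'m" where
  "Log_Gr Y0 B =
     (THE \<Delta>. \<exists>(Y1 :: real^'r^'m) U s V. represents Y1 B \<and> invertible (transpose Y0 ** Y1) \<and>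
        thin_svd (Y1 ** matrix_inv (transpose Y0 ** Y1) - Y0) U s V \<and>
        \<Delta> = U ** diag_mat (\<chi> i. arctan (s $ i)) ** transpose V)"

definition GLERP ::
  "'r::finite itself \<Rightarrow> (real^'m) set \<Rightarrow> (real^'m) set \<Rightarrow> real \<Rightarrow> (real^'m) set" where
  "GLERP (R :: 'r itself) A B c =
     (THE S. \<exists>Y0 :: real^'r^'m. represents Y0 A \<and> S = Exp_Gr Y0 (c *\<^sub>R Log_Gr Y0 B))"

text \<open>
  Geodesics are parametrised proportionally to arc length on \<open>[0,1]\<close>, so that \<open>s \<mapsto> Exp (s \<Delta>)\<close> has
  length \<open>sqrt (tr (\<Delta>\<^sup>T \<Delta>))\<close>; it is minimizing when this is the geodesic distance of its end points.
\<close>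

definition minimizing_geodesic ::
  "'r::finite itself \<Rightarrow> (real^'m) set \<Rightarrow> (real^'m) set \<Rightarrow> (real \<Rightarrow> (real^'m) set) \<Rightarrow> bool" where
  "minimizing_geodesic (R :: 'r itself) A B \<gamma> \<longleftrightarrow>
     (\<exists>Y \<Delta> :: real^'r^'m. represents Y A \<and> transpose Y ** \<Delta> = 0 \<and>
        (\<forall>s\<in>{0..1}. \<gamma> s = Exp_Gr Y (s *\<^sub>R \<Delta>)) \<and> \<gamma> 1 = B \<and>
        sqrt (trace (transpose \<Delta> ** \<Delta>)) = dist_Gr R A B)"

text \<open>Only the values of the curve on \<open>[0,1]\<close> matter, so uniqueness is agreement on \<open>[0,1]\<close>.\<close>

definition unique_minimizing_geodesic ::
  "'r::finite itself \<Rightarrow> (real^'m) set \<Rightarrow> (real^'m) set \<Rightarrow> bool" where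
  "unique_minimizing_geodesic R A B \<longleftrightarrow>
     (\<exists>\<gamma>. minimizing_geodesic R A B \<gamma> \<and>
        (\<forall>\<gamma>'. minimizing_geodesic R A B \<gamma>' \<longrightarrow> (\<forall>s\<in>{0..1}. \<gamma>' s = \<gamma> s)))"

definition node :: "real \<Rightarrow> real \<Rightarrow> nat \<Rightarrow> real" where
  "node t0 h j = t0 + real j * h"

definition weight :: "real \<Rightarrow> real \<Rightarrow> nat \<Rightarrow> nat \<Rightarrow> real \<Rightarrow> real" where
  "weight t0 h k j t = (t - node t0 h j) / (node t0 h (j + k) - node t0 h j)"

definition weight_bound :: "real \<Rightarrow> real \<Rightarrow> nat \<Rightarrow> real" where
  "weight_bound t0 h n =
     Max ((\<lambda>k. Max ((\<lambda>j. SUP t\<in>{t0..node t0 h n}. \<bar>weight t0 h k j t\<bar>) ` {0..n - k})) ` {1..n})"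

primrec radius_const :: "real \<Rightarrow> real \<Rightarrow> nat \<Rightarrow> real" where
  "radius_const A L 0 = A"
| "radius_const A L (Suc k) = (1 + 2 * L) * radius_const A L k"

text \<open>\<open>GIDER_sub R t0 h Y k j t\<close> is the level-\<open>k\<close> intermediate subspace with index \<open>j\<close> at \<open>t\<close>.\<close>

primrec GIDER_sub ::
  "'r::finite itself \<Rightarrow> real \<Rightarrow> real \<Rightarrow> (nat \<Rightarrow> (real^'m) set) \<Rightarrow> nat \<Rightarrow> nat \<Rightarrow> real \<Rightarrow> (real^'m) set"
where
  "GIDER_sub R t0 h Y 0 = (\<lambda>j t. Y j)"
| "GIDER_sub R t0 h Y (Suc k) =
     (\<lambda>j t. GLERP R (GIDER_sub R t0 h Y k j t) (GIDER_sub R t0 h Y k (Suc j) t)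
              (weight t0 h (Suc k) j t))"

end

theory Submission
  imports Defs
begin

text \<open>The distance is defined through singular values and not as an infimum of lengths, so its
  triangle inequality is proved as a spectral estimate. The convex function sends sin^2 theta to
  theta^2. Its slope theta / (sin theta cos theta) meets a first-order change 2 sin theta cos theta
  of the compression, so the gradient of \<open>F\<close> has size 2 sqrt \<open>F\<close>: hence
  the coefficient of d(B, C), which makes sqrt \<open>F\<close> 1-Lipschitz to first order. The same
  slope multiplies the second-order change and enters K, so it must be bounded. As sqrt is singular
  at 0, a small e^2 stays under it until the subdivision has been refined. A second obstacle is that
  Exp, Log, GLERP and the principal angles are definite descriptions over decompositions that are
  not unique when singular values repeat or vanish. What survives every choice is an even function
  of the singular values acting on right singular vectors (cos) and an odd one carrying them to left
  ones (sin, arctan). Since the weights may be negative or exceed 1, angles along a geodesic are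
  unrestricted and only bound the distance from above.\<close>

text \<open>
  By induction on the level, \<open>d(q, I) \<le> d(q, X) + |\<lambda>| d(X, Z)\<close> for a GLERP step from \<open>X\<close> towards \<open>Z\<close>, so
  everything reduces to explicit formulas for Exp and Log in principal bases and to the triangle
  inequality for \<open>d\<close>. A minimizing geodesic of length below \<open>pi / 2\<close> is itself described by principal
  bases of its end points, hence it is the curve \<open>GLERP\<close>; this gives uniqueness.

  For the triangle inequality, let \<open>F X = d(A, X)\<^sup>2\<close>. This is the trace of a convex function of the
  compression to \<open>A\<close> of the projection orthogonal to \<open>X\<close>, so Klein's inequality gives
  \<open>F C \<le> F B + 2 sqrt(F C) d(B, C) + K d(B, C)\<^sup>2\<close>. Subdividing a geodesic from \<open>B\<close> to \<open>C\<close> removes the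
  quadratic term. Since the convex function has infinite slope at angle \<open>pi / 2\<close>, an angle \<open>\<theta>\<close> is first
  replaced by \<open>arcsin (c sin \<theta>)\<close> with \<open>c < 1\<close>, and then \<open>c\<close> tends to 1.
\<close>

section \<open>Orthonormal families\<close>

definition orthonormal :: "('i \<Rightarrow> 'a::real_inner) \<Rightarrow> bool" where
  "orthonormal a \<longleftrightarrow> (\<forall>i j. a i \<bullet> a j = (if i = j then 1 else 0))"

definition onb :: "('i \<Rightarrow> 'a::real_inner) \<Rightarrow> 'a set \<Rightarrow> bool" where
  "onb a S \<longleftrightarrow> orthonormal a \<and> span (range a) = S"

lemma orthonormalD: "orthonormal a \<Longrightarrow> a i \<bullet> a j = (if i = j then 1 else 0)"
  by (simp add: orthonormal_def)

lemma orthonormal_norm: "orthonormal a \<Longrightarrow> norm (a i) = 1"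
  by (simp add: orthonormal_def norm_eq_sqrt_inner)

lemma onb_orthonormal: "onb a S \<Longrightarrow> orthonormal a"
  and onb_span: "onb a S \<Longrightarrow> span (range a) = S"
  by (simp_all add: onb_def)

lemma onb_mem: "onb a S \<Longrightarrow> a i \<in> S"
  by (auto simp: onb_def intro: span_base)

lemma onb_subspace: "onb a S \<Longrightarrow> subspace S"
  by (auto simp: onb_def)

lemma orthonormal_sum_inner:
  fixes a :: "'i::finite \<Rightarrow> 'a::real_inner"
  assumes "orthonormal a"
  shows "(\<Sum>i\<in>UNIV. c i *\<^sub>R a i) \<bullet> a j = c j"
  by (simp add: inner_sum_left orthonormalD[OF assms] if_distrib cong: if_cong)

lemma onb_expand:
  fixes a :: "'i::finite \<Rightarrow> 'a::real_inner"
  assumes "onb a S" "x \<in> S"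
  shows "x = (\<Sum>i\<in>UNIV. (x \<bullet> a i) *\<^sub>R a i)"
proof -
  let ?T = "{x. x = (\<Sum>i\<in>UNIV. (x \<bullet> a i) *\<^sub>R a i)}"
  have "subspace ?T"
    unfolding subspace_def mem_Collect_eq inner_add_left scaleR_add_left sum.distrib
      inner_scaleR_left scaleR_scaleR[symmetric] scaleR_sum_right[symmetric]
    by (auto intro: arg_cong2[of _ _ _ _ "(+)"])
  moreover have "range a \<subseteq> ?T"
    using onb_orthonormal[OF assms(1)]
    by (auto simp: orthonormal_def if_distrib[of "\<lambda>c. c *\<^sub>R _"] cong: if_cong)
  ultimately have "span (range a) \<subseteq> ?T"
    by (rule span_minimal[rotated])
  with assms show ?thesis
    by (auto simp: onb_def)
qed

lemma onb_inner:
  fixes a :: "'i::finite \<Rightarrow> 'a::real_inner"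
  assumes "onb a S" "x \<in> S"
  shows "x \<bullet> y = (\<Sum>i\<in>UNIV. (x \<bullet> a i) * (a i \<bullet> y))"
  by (subst onb_expand[OF assms]) (simp add: inner_sum_left)

lemma onb_parseval:
  fixes a :: "'i::finite \<Rightarrow> 'a::real_inner"
  assumes "onb a S" "x \<in> S"
  shows "(\<Sum>i\<in>UNIV. (x \<bullet> a i)\<^sup>2) = x \<bullet> x"
  by (subst onb_inner[OF assms]) (simp add: power2_eq_square inner_commute)

lemma bessel_ineq:
  fixes a :: "'i::finite \<Rightarrow> 'a::real_inner"
  assumes "orthonormal a"
  shows "(\<Sum>i\<in>UNIV. (x \<bullet> a i)\<^sup>2) \<le> x \<bullet> x"
proof -
  define p where "p = (\<Sum>i\<in>UNIV. (x \<bullet> a i) *\<^sub>R a i)"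
  have xp: "x \<bullet> p = (\<Sum>i\<in>UNIV. (x \<bullet> a i)\<^sup>2)"
    by (simp add: p_def inner_sum_right power2_eq_square)
  have "p \<bullet> p = (\<Sum>i\<in>UNIV. (x \<bullet> a i) * (p \<bullet> a i))"
    by (subst (2) p_def) (simp add: inner_sum_right)
  also have "\<dots> = (\<Sum>i\<in>UNIV. (x \<bullet> a i)\<^sup>2)"
    using orthonormal_sum_inner[OF assms, of "\<lambda>i. x \<bullet> a i"]
    by (simp add: p_def power2_eq_square)
  finally have pp: "p \<bullet> p = (\<Sum>i\<in>UNIV. (x \<bullet> a i)\<^sup>2)" .
  have "0 \<le> (x - p) \<bullet> (x - p)"
    by simp
  also have "\<dots> = x \<bullet> x - (\<Sum>i\<in>UNIV. (x \<bullet> a i)\<^sup>2)"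
    using xp pp by (simp add: inner_diff_left inner_diff_right inner_commute)
  finally show ?thesis
    by simp
qed

text \<open>Both sums equal the inner product of the orthogonal projections of \<open>x\<close> and
  \<open>y\<close> to \<open>B\<close>, and a projection does not see the basis.\<close>

lemma onb_inner_indep:
  fixes b b' :: "'i::finite \<Rightarrow> 'a::real_inner"
  assumes b: "onb b B" and b': "onb b' B"
  shows "(\<Sum>i\<in>UNIV. (x \<bullet> b i) * (y \<bullet> b i)) = (\<Sum>i\<in>UNIV. (x \<bullet> b' i) * (y \<bullet> b' i))"
proof -
  have "(\<Sum>i\<in>UNIV. (x \<bullet> b i) * (y \<bullet> b i))
      = (\<Sum>i\<in>UNIV. \<Sum>j\<in>UNIV. (b i \<bullet> b' j) * (b' j \<bullet> x) * (y \<bullet> b i))"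
    by (rule sum.cong[OF refl])
      (subst inner_commute, subst onb_inner[OF b' onb_mem[OF b]], simp add: sum_distrib_right)
  also have "\<dots> = (\<Sum>j\<in>UNIV. \<Sum>i\<in>UNIV. (b i \<bullet> b' j) * (b' j \<bullet> x) * (y \<bullet> b i))"
    by (rule sum.swap)
  also have "\<dots> = (\<Sum>j\<in>UNIV. (x \<bullet> b' j) * (y \<bullet> b' j))"
  proof (rule sum.cong[OF refl])
    fix j
    have "(\<Sum>i\<in>UNIV. (b i \<bullet> b' j) * (b' j \<bullet> x) * (y \<bullet> b i))
        = (b' j \<bullet> x) * (\<Sum>i\<in>UNIV. (b' j \<bullet> b i) * (b i \<bullet> y))"
      by (simp add: sum_distrib_left inner_commute mult_ac)
    also have "\<dots> = (b' j \<bullet> x) * (b' j \<bullet> y)"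
      by (simp only: onb_inner[OF b onb_mem[OF b'], symmetric])
    finally show "(\<Sum>i\<in>UNIV. (b i \<bullet> b' j) * (b' j \<bullet> x) * (y \<bullet> b i)) = (x \<bullet> b' j) * (y \<bullet> b' j)"
      by (simp add: inner_commute)
  qed
  finally show ?thesis .
qed

lemma orthonormal_inj: "orthonormal a \<Longrightarrow> inj a"
  by (metis (full_types) injI orthonormal_def zero_neq_one)

lemma orthonormal_independent:
  fixes a :: "'i::finite \<Rightarrow> 'a::euclidean_space"
  assumes "orthonormal a"
  shows "independent (range a)"
proof (rule pairwise_orthogonal_independent)
  show "pairwise orthogonal (range a)"
    using assms by (auto simp: pairwise_def orthogonal_def orthonormal_def)
  show "0 \<notin> range a"
    using orthonormal_norm[OF assms] by (metis imageE norm_zero zero_neq_one)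
qed

lemma onb_dim:
  fixes a :: "'i::finite \<Rightarrow> 'a::euclidean_space"
  assumes "onb a S"
  shows "dim S = CARD('i)"
  using orthonormal_independent[OF onb_orthonormal[OF assms]]
    card_image[OF orthonormal_inj[OF onb_orthonormal[OF assms]]]
  by (metis assms dim_span_eq_card_independent onb_span)

lemma onbI_dim:
  fixes a :: "'i::finite \<Rightarrow> 'a::euclidean_space"
  assumes "orthonormal a" "range a \<subseteq> S" "subspace S" "dim S = CARD('i)"
  shows "onb a S"
proof -
  have "onb a (span (range a))"
    using assms(1) by (simp add: onb_def)
  then have "dim (span (range a)) = dim S"
    using onb_dim assms(4) by metis
  with assms have "span (range a) = S"
    by (metis order_refl span_minimal subspace_dim_equal subspace_span)
  with assms(1) show ?thesis
    by (simp add: onb_def)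
qed

lemma orthonormal_onb_UNIV:
  fixes v :: "'r::finite \<Rightarrow> real^'r"
  assumes "orthonormal v"
  shows "onb v UNIV"
  using assms by (intro onbI_dim) (auto simp: dim_UNIV)

lemma exists_onb:
  assumes "S \<in> Gr (R :: 'r::finite itself)"
  shows "\<exists>a :: 'r \<Rightarrow> real^'m. onb a S"
proof -
  have S: "subspace S" "dim S = CARD('r)"
    using assms by (auto simp: Gr_def)
  obtain B where B: "B \<subseteq> S" "pairwise orthogonal B" "\<And>x. x \<in> B \<Longrightarrow> norm x = 1"
    "independent B" "card B = dim S" "span B = S"
    using orthonormal_basis_subspace[OF S(1)] by metis
  obtain a :: "'r \<Rightarrow> real^'m" where a: "bij_betw a UNIV B"
    using B(4,5) S(2) finite_same_card_bij[OF finite, of B "UNIV :: 'r set"]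
    by (metis bij_betw_iff_card finite independent_imp_finite)
  have "orthonormal a"
    unfolding orthonormal_def
  proof (intro allI)
    fix i j
    have "a i \<in> B" "a j \<in> B"
      using a by (auto simp: bij_betw_def)
    moreover have "a i = a j \<longleftrightarrow> i = j"
      using a by (auto simp: bij_betw_def inj_def)
    ultimately show "a i \<bullet> a j = (if i = j then 1 else 0)"
      using B(2,3) by (auto simp: pairwise_def orthogonal_def dot_square_norm)
  qed
  with a B(6) show ?thesis
    by (auto simp: onb_def bij_betw_def)
qed

lemma onb_Gr: "onb (a :: 'r::finite \<Rightarrow> real^'m) S \<Longrightarrow> S \<in> Gr (R :: 'r itself)"
  by (simp add: Gr_def onb_dim onb_subspace)

text \<open>Supplies left singular vectors where a singular value vanishes. The new vectors come
  from the orthogonal complement of the given ones, which is large enough because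
  \<open>CARD('r) \<le> DIM('a)\<close>.\<close>

lemma orthonormal_extend:
  fixes e :: "'r::finite \<Rightarrow> 'a::euclidean_space"
  assumes e: "\<And>i j. i \<in> I \<Longrightarrow> j \<in> I \<Longrightarrow> e i \<bullet> e j = (if i = j then 1 else 0)"
    and card: "CARD('r) \<le> DIM('a)"
  shows "\<exists>u. orthonormal u \<and> (\<forall>i\<in>I. u i = e i)"
proof -
  define W where "W = {y \<in> UNIV. \<forall>x\<in>span (e ` I). orthogonal x y}"
  have W: "subspace W"
    unfolding W_def using subspace_orthogonal_to_vectors[of "span (e ` I)"] by simp
  have "dim W + dim (span (e ` I)) = dim (UNIV :: 'a set)"
    unfolding W_def by (rule dim_subspace_orthogonal_to_vectors) auto
  then have "dim W + dim (e ` I) = dim (UNIV :: 'a set)"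
    by simp
  moreover have "dim (e ` I) \<le> card I"
    by (meson card_image_le dim_le_card' finite finite_imageI order_trans)
  ultimately have dimW: "card (- I) \<le> dim W"
    using card by (simp add: Compl_eq_Diff_UNIV card_Diff_subset)
  obtain B where B: "B \<subseteq> W" "pairwise orthogonal B" "\<And>x. x \<in> B \<Longrightarrow> norm x = 1"
    "independent B" "card B = dim W" "span B = W"
    using orthonormal_basis_subspace[OF W] by metis
  then obtain f where f: "inj_on f (- I)" "f ` (- I) \<subseteq> B"
    using dimW card_le_inj[of "- I" B] independent_imp_finite by auto
  define u where "u i = (if i \<in> I then e i else f i)" for i
  have WI: "e i \<bullet> f j = 0" if "i \<in> I" "j \<notin> I" for i j
    using that f(2) B(1) by (auto simp: W_def orthogonal_def span_base subset_iff image_subset_iff)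
  have WW: "f i \<bullet> f j = (if i = j then 1 else 0)" if "i \<notin> I" "j \<notin> I" for i j
  proof -
    have "f i \<in> B" "f j \<in> B" "f i = f j \<longleftrightarrow> i = j"
      using f that by (auto simp: inj_on_def)
    then show ?thesis
      using B(2,3) by (auto simp: pairwise_def orthogonal_def dot_square_norm)
  qed
  have "orthonormal u"
    unfolding orthonormal_def u_def using e WI WW by (auto simp: inner_commute)
  then show ?thesis
    by (auto simp: u_def)
qed

text \<open>The spectral theorem for f^T f in variational form. A unit vector \<open>x\<close> of
  \<open>W\<close> that maximises the norm of \<open>f x\<close> satisfies a first-order condition:
  every \<open>y\<close> of \<open>W\<close> orthogonal to \<open>x\<close> has \<open>f y\<close>
  orthogonal to \<open>f x\<close>. The induction then passes to the complement of \<open>x\<close>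
  in \<open>W\<close>.\<close>

lemma linear_orthogonal_basis:
  fixes f :: "'a::euclidean_space \<Rightarrow> 'b::real_inner"
  assumes f: "linear f" and "subspace W"
  shows "\<exists>B. B \<subseteq> W \<and> span B = W \<and> (\<forall>x\<in>B. norm x = 1) \<and>
    pairwise (\<lambda>x y. x \<bullet> y = 0 \<and> f x \<bullet> f y = 0) B"
  using assms(2)
proof (induction "dim W" arbitrary: W rule: less_induct)
  case less
  show ?case
  proof (cases "W = {0}")
    case True
    then show ?thesis
      by (intro exI[of _ "{}"]) (auto simp: pairwise_def)
  next
    case False
    let ?S = "sphere 0 1 \<inter> W"
    obtain w where w: "w \<in> W" "w \<noteq> 0"
      using False less.prems subspace_0 by blast
    have "compact ?S"
      by (simp add: closed_subspace compact_Int_closed less.prems)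
    moreover have "(1 / norm w) *\<^sub>R w \<in> ?S"
      using w less.prems by (simp add: subspace_scale)
    moreover have "continuous_on ?S (\<lambda>x. norm (f x))"
      using f by (intro continuous_intros linear_continuous_on) (simp add: linear_linear)
    ultimately obtain x where x: "x \<in> ?S" and max: "\<And>y. y \<in> ?S \<Longrightarrow> norm (f y) \<le> norm (f x)"
      using continuous_attains_sup[of ?S] by (metis empty_iff)
    have bound: "f y \<bullet> f y \<le> (f x \<bullet> f x) * (y \<bullet> y)" if "y \<in> W" for y
    proof (cases "y = 0")
      case True
      then show ?thesis using f by (simp add: linear_0)
    next
      case y: False
      have "(1 / norm y) *\<^sub>R y \<in> ?S"
        using y that less.prems by (simp add: subspace_scale)
      from max[OF this] have "norm (f y) \<le> norm (f x) * norm y"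
        using y f by (simp add: linear_scale divide_le_eq pos_divide_le_eq)
      then have "(norm (f y))\<^sup>2 \<le> (norm (f x) * norm y)\<^sup>2"
        by (simp add: power_mono)
      then show ?thesis
        by (simp add: dot_square_norm power_mult_distrib)
    qed
    have xx: "x \<bullet> x = 1"
      using x by (simp add: dot_square_norm)
    have orth: "f x \<bullet> f y = 0" if "y \<in> W" "x \<bullet> y = 0" for y
    proof (rule ccontr)
      assume p: "f x \<bullet> f y \<noteq> 0"
      define p where "p = f x \<bullet> f y"
      \<comment> \<open>\<open>bound\<close> at x + eps y gives 2 eps p <= eps^2 (k - 1). The choice
        eps = p / k makes the left side 2 p^2 / k and the right side less than p^2 / k. The summand
        1 keeps \<open>k\<close> positive.\<close>
      define k where "k = (f x \<bullet> f x) * (y \<bullet> y) + 1"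
      have k: "0 < k"
        by (simp add: k_def add_nonneg_pos)
      have "f (x + (p / k) *\<^sub>R y) \<bullet> f (x + (p / k) *\<^sub>R y)
          \<le> (f x \<bullet> f x) * ((x + (p / k) *\<^sub>R y) \<bullet> (x + (p / k) *\<^sub>R y))"
        using x that less.prems by (intro bound) (simp add: subspace_add subspace_scale)
      then have "2 * (p / k) * p + (p / k)\<^sup>2 * (f y \<bullet> f y) \<le> (f x \<bullet> f x) * ((p / k)\<^sup>2 * (y \<bullet> y))"
        using f that(2) xx
        by (simp add: linear_add linear_scale inner_add_left inner_add_right p_def[symmetric]
            inner_commute[of "f y" "f x"] inner_commute[of y x] power2_eq_square algebra_simps)
      moreover have "0 \<le> (p / k)\<^sup>2 * (f y \<bullet> f y)"
        by simp
      ultimately have "2 * (p / k) * p \<le> (f x \<bullet> f x) * ((p / k)\<^sup>2 * (y \<bullet> y))"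
        by linarith
      also have "\<dots> = (p / k)\<^sup>2 * (k - 1)"
        by (simp add: k_def)
      also have "\<dots> \<le> (p / k)\<^sup>2 * k"
        by (simp add: mult_left_mono)
      also have "\<dots> = (p / k) * p"
        using k by (simp add: power2_eq_square)
      finally have "p * p / k \<le> 0"
        by simp
      then show False
        using k p by (auto simp: p_def divide_le_0_iff mult_le_0_iff)
    qed
    define W' where "W' = {y \<in> W. x \<bullet> y = 0}"
    have W': "subspace W'"
      using less.prems by (auto simp: W'_def subspace_def inner_add_right)
    have "W' \<subset> W"
      using x xx unfolding W'_def by (metis (mono_tags, lifting) IntE mem_Collect_eq psubsetI
          subsetI zero_neq_one)
    then have "dim W' < dim W"
      using W' less.prems by (metis dim_psubset span_eq_iff)
    from less.hyps[OF this W'] obtain B where B: "B \<subseteq> W'" "span B = W'"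
      "\<forall>x\<in>B. norm x = 1" "pairwise (\<lambda>x y. x \<bullet> y = 0 \<and> f x \<bullet> f y = 0) B"
      by blast
    have BW: "insert x B \<subseteq> W"
      using B(1) x by (auto simp: W'_def)
    have "W \<subseteq> span (insert x B)"
    proof
      fix y assume y: "y \<in> W"
      have "y - (x \<bullet> y) *\<^sub>R x \<in> W'"
        using y x xx less.prems by (simp add: W'_def subspace_diff subspace_scale inner_diff_right)
      then have "y - (x \<bullet> y) *\<^sub>R x \<in> span B"
        using B(2) by simp
      then show "y \<in> span (insert x B)"
        by (auto simp: span_insert)
    qed
    then have "span (insert x B) = W"
      using BW less.prems by (metis span_minimal subset_antisym)
    moreover have "pairwise (\<lambda>x y. x \<bullet> y = 0 \<and> f x \<bullet> f y = 0) (insert x B)"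
      using B(1,4) orth by (auto simp: pairwise_insert W'_def inner_commute)
    ultimately show ?thesis
      using BW B(3) x by (intro exI[of _ "insert x B"]) auto
  qed
qed

section \<open>Singular value decompositions\<close>

definition family_matrix :: "('r::finite \<Rightarrow> real^'m) \<Rightarrow> real^'r^'m" where
  "family_matrix a = (\<chi> i j. a j $ i)"

lemma column_family_matrix [simp]: "column j (family_matrix a) = a j"
  by (simp add: family_matrix_def column_def vec_eq_iff)

lemma columns_eq_range: "columns M = range (\<lambda>i. column i M)"
  by (auto simp: columns_def)

lemma transpose_mult_component: "(transpose M ** N) $ i $ j = column i M \<bullet> column j N"
  for M :: "real^'r^'m" and N :: "real^'s^'m"
  by (simp add: matrix_matrix_mult_def transpose_def column_def inner_vec_def)

lemma transpose_mult_self_iff: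
  "transpose M ** M = mat 1 \<longleftrightarrow> orthonormal (\<lambda>i. column i M)" for M :: "real^'r^'m"
  by (simp add: vec_eq_iff transpose_mult_component orthonormal_def mat_def)

lemma represents_iff: "represents Y S \<longleftrightarrow> onb (\<lambda>i. column i Y) S"
  by (simp add: represents_def onb_def columns_eq_range transpose_mult_self_iff)

lemma matrix_eq_columns: "M = N \<longleftrightarrow> (\<forall>i. column i M = column i N)"
  by (auto simp: vec_eq_iff column_def)

lemma column_mult: "column i (M ** N) = M *v column i N"
  for M :: "real^'n^'m" and N :: "real^'k^'n"
  by (simp add: vec_eq_iff column_def matrix_matrix_mult_def matrix_vector_mult_def)

lemma column_diag_mat: "column i (diag_mat s) = s $ i *\<^sub>R axis i 1"
  by (auto simp: vec_eq_iff column_def diag_mat_def axis_def)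

lemma matrix_vector_axis: "M *v axis i 1 = column i M" for M :: "real^'r^'m"
  by (simp add: matrix_vector_mul_component vec_eq_iff column_def matrix_vector_mult_def axis_def
      if_distrib cong: if_cong)

lemma column_mult_diag: "column i (U ** diag_mat s) = s $ i *\<^sub>R column i U"
  for U :: "real^'r^'m"
  by (simp add: column_mult column_diag_mat matrix_vector_axis matrix_vector_mult_scaleR)

text \<open>Multiplication by the orthogonal \<open>V\<close> from the right is reversible. Read
  column by column, it turns the matrix factorisation into statements about vectors, the form in
  which all later arguments work.\<close>

lemma thin_svd_iff:
  "thin_svd M U s V \<longleftrightarrow> orthonormal (\<lambda>i. column i U) \<and> orthonormal (\<lambda>i. column i V) \<and>
     (\<forall>i. 0 \<le> s $ i) \<and> (\<forall>i. M *v column i V = s $ i *\<^sub>R column i U)"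
proof -
  have "M = U ** diag_mat s ** transpose V \<longleftrightarrow> M ** V = U ** diag_mat s"
    if "orthogonal_matrix V"
  proof
    have V: "transpose V ** V = mat 1" "V ** transpose V = mat 1"
      using that by (simp_all add: orthogonal_matrix_def)
    show "M ** V = U ** diag_mat s" if "M = U ** diag_mat s ** transpose V"
      unfolding that by (simp add: V flip: matrix_mul_assoc)
    show "M = U ** diag_mat s ** transpose V" if "M ** V = U ** diag_mat s"
      unfolding that[symmetric] by (simp add: V flip: matrix_mul_assoc)
  qed
  moreover have "M ** V = U ** diag_mat s \<longleftrightarrow> (\<forall>i. M *v column i V = s $ i *\<^sub>R column i U)"
    by (simp add: matrix_eq_columns column_mult_diag column_mult[of _ M])
  ultimately show ?thesis
    by (auto simp: thin_svd_def transpose_mult_self_iff orthogonal_matrix)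
qed

lemma represents_family_matrix: "represents (family_matrix a) S \<longleftrightarrow> onb a S"
  by (simp add: represents_iff)

lemma matrix_vector_columns: "M *v x = (\<Sum>i\<in>UNIV. x $ i *\<^sub>R column i M)" for M :: "real^'r^'m"
  by (simp add: matrix_mult_sum scalar_mult_eq_scaleR)

lemma represents_range:
  assumes "represents Y S"
  shows "range ((*v) Y) = S"
proof
  have onb: "onb (\<lambda>i. column i Y) S"
    using assms by (simp add: represents_iff)
  then show "range ((*v) Y) \<subseteq> S"
    by (auto simp: matrix_vector_columns
        intro!: subspace_sum subspace_scale onb_subspace onb_mem[OF onb])
  show "S \<subseteq> range ((*v) Y)"
  proof
    fix x assume "x \<in> S"
    then have "x = Y *v (\<chi> i. x \<bullet> column i Y)"
      using onb_expand[OF onb] by (simp add: matrix_vector_columns)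
    then show "x \<in> range ((*v) Y)"
      by blast
  qed
qed

lemma transpose_adjoint: "(transpose Y *v x) \<bullet> y = x \<bullet> (Y *v y)" for Y :: "real^'r^'m"
  by (simp add: transpose_matrix_vector dot_lmul_matrix)

lemma represents_inner:
  assumes "represents Y S"
  shows "(Y *v x) \<bullet> (Y *v y) = x \<bullet> y"
  using assms unfolding transpose_adjoint[symmetric] matrix_vector_mul_assoc
  by (simp add: represents_def)

lemma represents_projection:
  assumes "represents Y S" "x \<in> S"
  shows "Y *v (transpose Y *v x) = x"
proof -
  obtain y where y: "x = Y *v y"
    using assms represents_range[OF assms(1)] by blast
  have "transpose Y *v x = y"
    unfolding y matrix_vector_mul_assoc using assms(1) by (simp add: represents_def)
  then show ?thesis
    by (simp add: y)
qed

text \<open>The basis of \<open>linear_orthogonal_basis\<close> gives the right singular vectors and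
  its normalised images the left ones. A zero singular value determines no left vector, so
  \<open>orthonormal_extend\<close> chooses it.\<close>

lemma exists_svd:
  fixes M :: "real^'r::finite^'m::finite"
  assumes "CARD('r) \<le> CARD('m)"
  shows "\<exists>u s v. orthonormal u \<and> orthonormal v \<and> (\<forall>i. 0 \<le> s i) \<and>
    (\<forall>i::'r. M *v v i = s i *\<^sub>R u i)"
proof -
  obtain B where B: "span B = UNIV" "\<forall>x\<in>B. norm x = 1"
    "pairwise (\<lambda>x y. x \<bullet> y = 0 \<and> (M *v x) \<bullet> (M *v y) = 0) B"
    using linear_orthogonal_basis[of "(*v) M" UNIV] by auto
  have "independent B"
    using B(2,3) by (intro pairwise_orthogonal_independent) (auto simp: pairwise_def orthogonal_def)
  then have "card B = CARD('r)" "finite B"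
    using dim_span_eq_card_independent[of B] by (simp_all add: B(1) independent_imp_finite)
  then obtain v :: "'r \<Rightarrow> real^'r" where v: "bij_betw v UNIV B"
    using finite_same_card_bij[of "UNIV :: 'r set" B] by auto
  have v_eq: "v i = v j \<longleftrightarrow> i = j" and vB: "v i \<in> B" for i j
    using v by (auto simp: bij_betw_def inj_def)
  have orth_v: "orthonormal v"
    using B(2,3) vB v_eq by (auto simp: orthonormal_def pairwise_def dot_square_norm)
  define s where "s i = norm (M *v v i)" for i
  define e where "e i = (1 / s i) *\<^sub>R (M *v v i)" for i
  have e: "e i \<bullet> e j = (if i = j then 1 else 0)"
    if "i \<in> {i. s i \<noteq> 0}" "j \<in> {i. s i \<noteq> 0}" for i j
    using B(3) vB[of i] vB[of j] v_eq[of i j] that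
    by (auto simp: e_def s_def pairwise_def dot_square_norm power2_eq_square)
  obtain u where u: "orthonormal u" "\<forall>i\<in>{i. s i \<noteq> 0}. u i = e i"
    using orthonormal_extend[of "{i. s i \<noteq> 0}" e] e assms by auto
  have "M *v v i = s i *\<^sub>R u i" for i
    using u(2) by (cases "s i = 0") (auto simp: e_def s_def)
  with u(1) orth_v show ?thesis
    by (intro exI[of _ u] exI[of _ s] exI[of _ v]) (auto simp: s_def)
qed

section \<open>Functions of singular values and the exponential map\<close>

text \<open>
  Signs are allowed here, so that scaling a tangent vector by a negative factor keeps its singular
  vectors.
\<close>

definition signed_svd ::
  "real^'r::finite^'m::finite \<Rightarrow> ('r \<Rightarrow> real^'m) \<Rightarrow> ('r \<Rightarrow> real) \<Rightarrow> ('r \<Rightarrow> real^'r) \<Rightarrow> bool" where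
  "signed_svd M u s v \<longleftrightarrow> orthonormal u \<and> orthonormal v \<and> (\<forall>i. M *v v i = s i *\<^sub>R u i)"

lemma thin_svd_signed_svd:
  "thin_svd M U s V \<Longrightarrow> signed_svd M (\<lambda>i. column i U) (\<lambda>i. s $ i) (\<lambda>i. column i V)"
  by (simp add: thin_svd_iff signed_svd_def)

lemma signed_svd_scale: "signed_svd M u s v \<Longrightarrow> signed_svd (c *\<^sub>R M) u (\<lambda>i. c * s i) v"
  by (simp add: signed_svd_def flip: scaleR_matrix_vector_assoc)

text \<open>This is M^T M v_i = s_i^2 v_i, tested against M^T M-free vectors
  \<open>y\<close>.\<close>

lemma signed_svd_inner:
  assumes "signed_svd M u s v"
  shows "(M *v v i) \<bullet> (M *v y) = (s i)\<^sup>2 * (v i \<bullet> y)"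
proof -
  have v: "onb v UNIV" and Mv: "\<And>i. M *v v i = s i *\<^sub>R u i" and u: "orthonormal u"
    using assms by (auto simp: signed_svd_def orthonormal_onb_UNIV)
  have "M *v y = (\<Sum>j\<in>UNIV. (y \<bullet> v j) *\<^sub>R (s j *\<^sub>R u j))"
    by (subst onb_expand[OF v UNIV_I, of y])
      (simp add: matrix_vector_right_distrib mult.assoc Mv linear_sum[OF matrix_vector_mul_linear]
        matrix_vector_mult_scaleR)
  then show ?thesis
    by (simp add: Mv inner_sum_right orthonormalD[OF u] power2_eq_square inner_commute if_distrib
        cong: if_cong)
qed

text \<open>Eigenvectors of the symmetric matrix M^T M for different eigenvalues are
  orthogonal.\<close>

lemma signed_svd_unique_values:
  assumes "signed_svd M u s v" "signed_svd M u' s' v'" "v i \<bullet> v' j \<noteq> 0"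
  shows "(s i)\<^sup>2 = (s' j)\<^sup>2"
  using signed_svd_inner[OF assms(1), of i "v' j"] signed_svd_inner[OF assms(2), of j "v i"] assms(3)
  by (simp add: inner_commute)

text \<open>Both sides are f (sqrt (M^T M)) applied to \<open>v' j\<close>. An even \<open>f\<close>
  depends on the square of the singular value alone, and that square is an eigenvalue of M^T
  M.\<close>

lemma signed_svd_even:
  assumes svd: "signed_svd M u s v" "signed_svd M u' s' v'"
    and even: "\<And>x. f (- x) = f (x::real)"
  shows "f (s' j) *\<^sub>R v' j = (\<Sum>i\<in>UNIV. (v' j \<bullet> v i) *\<^sub>R f (s i) *\<^sub>R v i)"
proof -
  have v: "onb v UNIV"
    using svd(1) by (simp add: signed_svd_def orthonormal_onb_UNIV)
  have "(v' j \<bullet> v i) * f (s i) = (v' j \<bullet> v i) * f (s' j)" for i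
    using signed_svd_unique_values[OF svd, of i j] even[of "s' j"]
    by (cases "v i \<bullet> v' j = 0") (auto simp: inner_commute power2_eq_iff)
  then have "(\<Sum>i\<in>UNIV. (v' j \<bullet> v i) *\<^sub>R f (s i) *\<^sub>R v i)
      = f (s' j) *\<^sub>R (\<Sum>i\<in>UNIV. (v' j \<bullet> v i) *\<^sub>R v i)"
    unfolding scaleR_sum_right scaleR_scaleR by (intro sum.cong refl) (simp add: mult.commute)
  then show ?thesis
    using onb_expand[OF v UNIV_I, of "v' j"] by simp
qed

text \<open>An odd \<open>f\<close> is x times an even function \<open>g\<close>, so this is
  \<open>M\<close> applied to the even case. Division by zero sets \<open>g 0\<close> to 0, which is
  consistent because \<open>f 0 = 0\<close>.\<close>

lemma signed_svd_odd:
  assumes svd: "signed_svd M u s v" "signed_svd M u' s' v'"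
    and odd: "\<And>x. f (- x) = - f (x::real)"
  shows "f (s' j) *\<^sub>R u' j = (\<Sum>i\<in>UNIV. (v' j \<bullet> v i) *\<^sub>R f (s i) *\<^sub>R u i)"
proof -
  define g where "g x = f x / x" for x
  have f0: "f 0 = 0"
    using odd[of 0] by simp
  have M: "M *v v i = s i *\<^sub>R u i" "M *v v' i = s' i *\<^sub>R u' i" for i
    using svd by (auto simp: signed_svd_def)
  have g: "f x *\<^sub>R y = g x *\<^sub>R (x *\<^sub>R y)" for x and y :: "real^'b"
    using f0 by (cases "x = 0") (auto simp: g_def)
  have "f (s' j) *\<^sub>R u' j = M *v (g (s' j) *\<^sub>R v' j)"
    by (simp add: g M matrix_vector_mult_scaleR)
  also have "g (s' j) *\<^sub>R v' j = (\<Sum>i\<in>UNIV. (v' j \<bullet> v i) *\<^sub>R g (s i) *\<^sub>R v i)"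
    by (rule signed_svd_even[OF svd]) (simp add: g_def odd)
  also have "M *v \<dots> = (\<Sum>i\<in>UNIV. (v' j \<bullet> v i) *\<^sub>R f (s i) *\<^sub>R u i)"
    by (simp add: g M linear_sum[OF matrix_vector_mul_linear] matrix_vector_mult_scaleR mult_ac)
  finally show ?thesis .
qed

lemma signed_svd_thin_svd:
  assumes "signed_svd M u s v"
  shows "\<exists>U V. thin_svd M U (\<chi> i. \<bar>s i\<bar>) V \<and>
    (\<forall>i. column i V = v i \<and> column i U = (if s i < 0 then - u i else u i))"
proof -
  define u' where "u' i = (if s i < 0 then - u i else u i)" for i
  have "orthonormal u'"
    using assms by (auto simp: signed_svd_def orthonormal_def u'_def)
  then have "thin_svd M (family_matrix u') (\<chi> i. \<bar>s i\<bar>) (family_matrix v)"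
    using assms by (simp add: thin_svd_iff signed_svd_def) (simp add: u'_def abs_if)
  then show ?thesis
    by (intro exI[of _ "family_matrix u'"] exI[of _ "family_matrix v"]) (auto simp: u'_def)
qed

text \<open>Column i of Y V cos Theta + U sin Theta, when \<open>a i\<close> is Y applied to column
  i of V and \<open>u i\<close> is column i of U.\<close>

definition exp_family ::
  "('r \<Rightarrow> real^'m) \<Rightarrow> ('r \<Rightarrow> real^'m) \<Rightarrow> ('r \<Rightarrow> real) \<Rightarrow> 'r \<Rightarrow> real^'m" where
  "exp_family a u \<theta> i = cos (\<theta> i) *\<^sub>R a i + sin (\<theta> i) *\<^sub>R u i"

text \<open>Makes the \<open>THE\<close> in \<open>Exp_Gr\<close> meaningful. Since cos is even and
  sin is odd, both parts of a vector of one family expand in the other family with the same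
  coefficients \<open>v' j \<bullet> v i\<close>.\<close>

lemma exp_family_span_mono:
  fixes M Y :: "real^'r::finite^'m::finite"
  assumes "signed_svd M u s v" "signed_svd M u' s' v'"
  shows "span (range (exp_family (\<lambda>i. Y *v v' i) u' s')) \<subseteq> span (range (exp_family (\<lambda>i. Y *v v i) u s))"
proof (rule span_minimal)
  show "range (exp_family (\<lambda>i. Y *v v' i) u' s') \<subseteq> span (range (exp_family (\<lambda>i. Y *v v i) u s))"
  proof clarify
    fix j
    have "cos (s' j) *\<^sub>R (Y *v v' j) = Y *v (cos (s' j) *\<^sub>R v' j)"
      by (simp add: matrix_vector_mult_scaleR)
    also have "\<dots> = (\<Sum>i\<in>UNIV. (v' j \<bullet> v i) *\<^sub>R cos (s i) *\<^sub>R (Y *v v i))"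
      by (simp only: signed_svd_even[OF assms, where f = cos and j = j, OF cos_minus]
          linear_sum[OF matrix_vector_mul_linear] matrix_vector_mult_scaleR)
    finally have "exp_family (\<lambda>i. Y *v v' i) u' s' j
        = (\<Sum>i\<in>UNIV. (v' j \<bullet> v i) *\<^sub>R cos (s i) *\<^sub>R (Y *v v i))
          + (\<Sum>i\<in>UNIV. (v' j \<bullet> v i) *\<^sub>R sin (s i) *\<^sub>R u i)"
      by (simp only: exp_family_def signed_svd_odd[OF assms, where f = sin and j = j, OF sin_minus])
    also have "\<dots> = (\<Sum>i\<in>UNIV. (v' j \<bullet> v i) *\<^sub>R exp_family (\<lambda>i. Y *v v i) u s i)"
      by (simp only: exp_family_def sum.distrib scaleR_add_right)
    finally have eq: "exp_family (\<lambda>i. Y *v v' i) u' s' j = \<dots>" .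
    then show "exp_family (\<lambda>i. Y *v v' i) u' s' j \<in> span (range (exp_family (\<lambda>i. Y *v v i) u s))"
      unfolding eq by (intro span_sum span_scale span_base rangeI)
  qed
qed simp

lemma Exp_Gr_eq:
  fixes \<Delta> Y :: "real^'r::finite^'m::finite"
  assumes svd: "signed_svd \<Delta> u \<theta> v"
  shows "Exp_Gr Y \<Delta> = span (range (exp_family (\<lambda>i. Y *v v i) u \<theta>))"
  unfolding Exp_Gr_def
proof (rule the_equality)
  have cols: "columns (Y ** V ** diag_mat (\<chi> i. cos (\<phi> $ i)) + U ** diag_mat (\<chi> i. sin (\<phi> $ i)))
      = range (exp_family (\<lambda>i. Y *v column i V) (\<lambda>i. column i U) (\<lambda>i. \<phi> $ i))"
    for U :: "real^'r^'m" and \<phi> V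
  proof -
    have "column i (M + N) = column i M + column i N" for M N :: "real^'r^'m" and i
      by (simp add: column_def vec_eq_iff)
    then show ?thesis
      by (simp add: columns_eq_range exp_family_def column_mult_diag column_mult[of _ Y])
  qed
  obtain U V where UV: "thin_svd \<Delta> U (\<chi> i. \<bar>\<theta> i\<bar>) V" "\<And>i. column i V = v i"
    "\<And>i. column i U = (if \<theta> i < 0 then - u i else u i)"
    using signed_svd_thin_svd[OF svd] by blast
  \<comment> \<open>Moving a sign from \<open>\<theta> i\<close> to \<open>u i\<close> changes
    neither the cosine nor the product of the sine with the direction.\<close>
  have "exp_family (\<lambda>i. Y *v column i V) (\<lambda>i. column i U) (\<lambda>i. (\<chi> i. \<bar>\<theta> i\<bar>) $ i)
      = exp_family (\<lambda>i. Y *v v i) u \<theta>"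
    by (auto simp: exp_family_def UV abs_if)
  then have "thin_svd \<Delta> U (\<chi> i. \<bar>\<theta> i\<bar>) V \<and> span (range (exp_family (\<lambda>i. Y *v v i) u \<theta>)) =
      span (columns (Y ** V ** diag_mat (\<chi> i. cos ((\<chi> i. \<bar>\<theta> i\<bar>) $ i))
        + U ** diag_mat (\<chi> i. sin ((\<chi> i. \<bar>\<theta> i\<bar>) $ i))))"
    using UV(1) by (simp only: cols)
  then show "\<exists>U \<phi> V. thin_svd \<Delta> U \<phi> V \<and> span (range (exp_family (\<lambda>i. Y *v v i) u \<theta>)) =
      span (columns (Y ** V ** diag_mat (\<chi> i. cos (\<phi> $ i)) + U ** diag_mat (\<chi> i. sin (\<phi> $ i))))"
    by blast
  fix S
  assume "\<exists>U \<phi> V. thin_svd \<Delta> U \<phi> V \<and> S =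
      span (columns (Y ** V ** diag_mat (\<chi> i. cos (\<phi> $ i)) + U ** diag_mat (\<chi> i. sin (\<phi> $ i))))"
  then obtain U \<phi> V where "thin_svd \<Delta> U \<phi> V"
    and S: "S = span (range (exp_family (\<lambda>i. Y *v column i V) (\<lambda>i. column i U) (\<lambda>i. \<phi> $ i)))"
    unfolding cols by blast
  then have svd': "signed_svd \<Delta> (\<lambda>i. column i U) (\<lambda>i. \<phi> $ i) (\<lambda>i. column i V)"
    by (simp add: thin_svd_signed_svd)
  show "S = span (range (exp_family (\<lambda>i. Y *v v i) u \<theta>))"
    unfolding S using exp_family_span_mono[OF svd svd'] exp_family_span_mono[OF svd' svd]
    by (rule subset_antisym)
qed

section \<open>Principal angles\<close>

text \<open>Principal bases of \<open>A\<close> and \<open>B\<close>. Only the cosines of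
  \<open>\<theta>\<close> are prescribed: the angles may be negative or exceed pi / 2, as happens
  along an extended geodesic.\<close>

definition angle_frame ::
  "('r::finite \<Rightarrow> real^'m::finite) \<Rightarrow> ('r \<Rightarrow> real^'m) \<Rightarrow> ('r \<Rightarrow> real) \<Rightarrow> (real^'m) set \<Rightarrow> (real^'m) set \<Rightarrow> bool"
where
  "angle_frame a b \<theta> A B \<longleftrightarrow>
     onb a A \<and> onb b B \<and> (\<forall>i j. a i \<bullet> b j = (if i = j then cos (\<theta> i) else 0))"

lemma angle_frameD:
  assumes "angle_frame a b \<theta> A B"
  shows "onb a A" "onb b B" "a i \<bullet> b j = (if i = j then cos (\<theta> i) else 0)"
    "b i \<bullet> a j = (if i = j then cos (\<theta> i) else 0)"
  using assms by (auto simp: angle_frame_def inner_commute)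

text \<open>The orthogonal projection of \<open>b j\<close> to \<open>A\<close> is cos (theta_j)
  a_j.\<close>

lemma angle_frame_inner:
  assumes "angle_frame a b \<theta> A B" "x \<in> A"
  shows "x \<bullet> b j = cos (\<theta> j) * (x \<bullet> a j)"
  using onb_inner[OF angle_frameD(1)[OF assms(1)] assms(2), of "b j"]
  by (simp add: angle_frameD(3)[OF assms(1)] if_distrib mult.commute cong: if_cong)

text \<open>With P the projection to \<open>B\<close>, the form <P x, P y> on \<open>A\<close> is
  diagonal in both \<open>a\<close> and \<open>a'\<close>, with eigenvalues cos^2. Eigenvectors for
  different eigenvalues are orthogonal.\<close>

lemma angle_frame_unique_values:
  fixes a b a' b' :: "'r::finite \<Rightarrow> real^'m::finite"
  assumes f: "angle_frame a b \<theta> A B" and f': "angle_frame a' b' \<theta>' A B"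
    and ne: "a i \<bullet> a' j \<noteq> 0"
  shows "(cos (\<theta> i))\<^sup>2 = (cos (\<theta>' j))\<^sup>2"
proof -
  have "(\<Sum>k\<in>UNIV. (a i \<bullet> b k) * (a' j \<bullet> b k)) = (\<Sum>k\<in>UNIV. (a i \<bullet> b' k) * (a' j \<bullet> b' k))"
    by (rule onb_inner_indep[OF angle_frameD(2)[OF f] angle_frameD(2)[OF f']])
  moreover have "(\<Sum>k\<in>UNIV. (a i \<bullet> b k) * (a' j \<bullet> b k)) = (cos (\<theta> i))\<^sup>2 * (a i \<bullet> a' j)"
    using angle_frame_inner[OF f onb_mem[OF angle_frameD(1)[OF f']], of j i]
    by (simp add: angle_frameD(3)[OF f] if_distrib[of "\<lambda>x. x * _"] power2_eq_square inner_commute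
        cong: if_cong)
  moreover have "(\<Sum>k\<in>UNIV. (a i \<bullet> b' k) * (a' j \<bullet> b' k)) = (cos (\<theta>' j))\<^sup>2 * (a i \<bullet> a' j)"
    using angle_frame_inner[OF f' onb_mem[OF angle_frameD(1)[OF f]], of i j]
    by (simp add: angle_frameD(3)[OF f'] if_distrib[of "\<lambda>x. _ * x"] power2_eq_square inner_commute
        cong: if_cong)
  ultimately show ?thesis
    using ne by simp
qed

text \<open>The squares of \<open>a i \<bullet> a' j\<close> form a doubly stochastic matrix, and
  the row sums 1 are inserted here. Exchanging the two bases does the same with the column
  sums.\<close>

lemma onb_double_sum:
  fixes a a' :: "'r::finite \<Rightarrow> real^'m"
  assumes "onb a A" "onb a' A"
  shows "(\<Sum>i\<in>UNIV. g i) = (\<Sum>i\<in>UNIV. \<Sum>j\<in>UNIV. (a i \<bullet> a' j)\<^sup>2 * g i)"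
proof -
  have "(\<Sum>j\<in>UNIV. (a i \<bullet> a' j)\<^sup>2 * g i) = g i" for i
    using onb_parseval[OF assms(2) onb_mem[OF assms(1)], of i]
      orthonormalD[OF onb_orthonormal[OF assms(1)], of i i]
    by (simp flip: sum_distrib_right)
  then show ?thesis
    by simp
qed

text \<open>Spread both sums over the doubly stochastic weights: a weight is nonzero only where the
  two angles agree, since cos is nonnegative and injective on [0, pi / 2].\<close>

lemma angle_frame_sum_eq:
  fixes a b a' b' :: "'r::finite \<Rightarrow> real^'m::finite"
    and g :: "real \<Rightarrow> real"
  assumes f: "angle_frame a b \<theta> A B" and f': "angle_frame a' b' \<theta>' A B"
    and \<theta>: "\<And>i. 0 \<le> \<theta> i \<and> \<theta> i \<le> pi / 2" "\<And>i. 0 \<le> \<theta>' i \<and> \<theta>' i \<le> pi / 2"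
  shows "(\<Sum>i\<in>UNIV. g (\<theta> i)) = (\<Sum>j\<in>UNIV. g (\<theta>' j))"
proof -
  have eq: "\<theta> i = \<theta>' j" if "a i \<bullet> a' j \<noteq> 0" for i j
  proof -
    have "(cos (\<theta> i))\<^sup>2 = (cos (\<theta>' j))\<^sup>2"
      by (rule angle_frame_unique_values[OF f f' that])
    then have "cos (\<theta> i) = cos (\<theta>' j)"
      by (rule power2_eq_imp_eq)
        (use \<theta>(1)[of i] \<theta>(2)[of j] in \<open>auto intro!: cos_ge_zero\<close>)
    then show ?thesis
      using \<theta>(1)[of i] \<theta>(2)[of j] cos_inj_pi[of "\<theta> i" "\<theta>' j"] by auto
  qed
  have "(\<Sum>i\<in>UNIV. g (\<theta> i)) = (\<Sum>i\<in>UNIV. \<Sum>j\<in>UNIV. (a i \<bullet> a' j)\<^sup>2 * g (\<theta> i))"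
    using f f' by (intro onb_double_sum) (auto simp: angle_frame_def)
  also have "\<dots> = (\<Sum>i\<in>UNIV. \<Sum>j\<in>UNIV. (a i \<bullet> a' j)\<^sup>2 * g (\<theta>' j))"
    using eq by (intro sum.cong refl) fastforce
  also have "\<dots> = (\<Sum>j\<in>UNIV. \<Sum>i\<in>UNIV. (a' j \<bullet> a i)\<^sup>2 * g (\<theta>' j))"
    by (subst sum.swap) (simp add: inner_commute)
  also have "\<dots> = (\<Sum>j\<in>UNIV. g (\<theta>' j))"
    using f f' by (intro onb_double_sum[symmetric]) (auto simp: angle_frame_def)
  finally show ?thesis .
qed

lemma represents_image_onb:
  fixes Y :: "real^'r::finite^'m::finite"
  assumes "represents Y S" "orthonormal v"
  shows "onb (\<lambda>i::'r. Y *v v i) S"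
proof (rule onbI_dim)
  have onb: "onb (\<lambda>i. column i Y) S"
    using assms(1) by (simp add: represents_iff)
  show "orthonormal (\<lambda>i. Y *v v i)"
    using assms(2) by (simp add: orthonormal_def represents_inner[OF assms(1)])
  show "range (\<lambda>i. Y *v v i) \<subseteq> S"
    using represents_range[OF assms(1)] by auto
  show "subspace S" "dim S = CARD('r)"
    using onb onb_subspace onb_dim by blast+
qed

lemma svd_angle_frame:
  fixes Y0 Y1 :: "real^'r::finite^'m::finite" and u v :: "'r \<Rightarrow> real^'r"
  assumes Y: "represents Y0 A" "represents Y1 B"
    and svd: "orthonormal u" "orthonormal v" "\<And>i. (transpose Y0 ** Y1) *v v i = cos (\<theta> i) *\<^sub>R u i"
  shows "angle_frame (\<lambda>i. Y0 *v u i) (\<lambda>i. Y1 *v v i) \<theta> A B"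
proof -
  have "(Y0 *v u i) \<bullet> (Y1 *v v j) = ((transpose Y0 ** Y1) *v v j) \<bullet> u i" for i j
    unfolding matrix_vector_mul_assoc[symmetric] transpose_adjoint by (rule inner_commute)
  then show ?thesis
    using svd by (simp add: angle_frame_def represents_image_onb Y orthonormalD)
qed

lemma principal_angles_eq:
  fixes a :: "'r::finite \<Rightarrow> real^'m::finite"
  assumes f: "angle_frame a b \<theta> A B" and \<theta>: "\<And>i. 0 \<le> \<theta> i \<and> \<theta> i \<le> pi / 2"
  shows "principal_angles (R :: 'r itself) A B = image_mset \<theta> (mset_set UNIV)"
  unfolding principal_angles_def
proof (rule the_equality)
  have cos: "0 \<le> cos (\<theta> i)" for i
    using \<theta>[of i] by (intro cos_ge_zero) auto
  have "transpose (family_matrix a) ** family_matrix b = diag_mat (\<chi> i. cos (\<theta> i))"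
    by (simp add: vec_eq_iff transpose_mult_component angle_frameD(3)[OF f] diag_mat_def)
  then have "thin_svd (transpose (family_matrix a) ** family_matrix b) (mat 1)
      (\<chi> i. cos ((\<chi> i. \<theta> i) $ i)) (mat 1)"
    by (simp add: thin_svd_def orthogonal_matrix_id cos)
  moreover have "represents (family_matrix a) A" "represents (family_matrix b) B"
    using f by (auto simp: represents_family_matrix angle_frame_def)
  ultimately show "\<exists>(Y0 :: real^'r^'m) (Y1 :: real^'r^'m) U \<phi> V. represents Y0 A \<and> represents Y1 B \<and>
        (\<forall>i. 0 \<le> \<phi> $ i \<and> \<phi> $ i \<le> pi / 2) \<and>
        thin_svd (transpose Y0 ** Y1) U (\<chi> i. cos (\<phi> $ i)) V \<and>
        image_mset \<theta> (mset_set UNIV) = image_mset (\<lambda>i. \<phi> $ i) (mset_set UNIV)"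
    using \<theta>
    by - (rule exI[of _ "family_matrix a"], rule exI[of _ "family_matrix b"], rule exI[of _ "mat 1"],
        rule exI[of _ "\<chi> i. \<theta> i"], rule exI[of _ "mat 1"], simp)
  fix T
  assume "\<exists>(Y0 :: real^'r^'m) (Y1 :: real^'r^'m) U \<phi> V. represents Y0 A \<and> represents Y1 B \<and>
        (\<forall>i. 0 \<le> \<phi> $ i \<and> \<phi> $ i \<le> pi / 2) \<and>
        thin_svd (transpose Y0 ** Y1) U (\<chi> i. cos (\<phi> $ i)) V \<and>
        T = image_mset (\<lambda>i. \<phi> $ i) (mset_set UNIV)"
  then obtain Y0 Y1 :: "real^'r^'m" and U \<phi> V where Y: "represents Y0 A" "represents Y1 B"
    and \<phi>: "\<And>i. 0 \<le> \<phi> $ i \<and> \<phi> $ i \<le> pi / 2"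
    and svd: "thin_svd (transpose Y0 ** Y1) U (\<chi> i. cos (\<phi> $ i)) V"
    and T: "T = image_mset (\<lambda>i. \<phi> $ i) (mset_set UNIV)"
    by blast
  have f': "angle_frame (\<lambda>i. Y0 *v column i U) (\<lambda>i. Y1 *v column i V) (\<lambda>i. \<phi> $ i) A B"
    using svd by (intro svd_angle_frame Y) (auto simp: thin_svd_iff)
  show "T = image_mset \<theta> (mset_set UNIV)"
    unfolding T
  proof (rule multiset_eqI)
    fix x
    \<comment> \<open>The indicator of \<open>x\<close>, taken as the function \<open>g\<close> of
      \<open>angle_frame_sum_eq\<close>, turns equality of sums into equality of
      multiplicities.\<close>
    have count: "real (count (image_mset \<psi> (mset_set UNIV)) x)
        = (\<Sum>i\<in>UNIV. if \<psi> i = x then 1 else 0)" for \<psi> :: "'r \<Rightarrow> real"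
      by (simp add: count_image_mset vimage_def sum.If_cases)
    have "real (count (image_mset (($) \<phi>) (mset_set UNIV)) x)
        = real (count (image_mset \<theta> (mset_set UNIV)) x)"
      unfolding count by (rule angle_frame_sum_eq[OF f' f \<phi> \<theta>])
    then show "count (image_mset (($) \<phi>) (mset_set UNIV)) x
        = count (image_mset \<theta> (mset_set UNIV)) x"
      by simp
  qed
qed

lemma exists_angle_frame:
  fixes A B :: "(real^'m::finite) set"
  assumes "A \<in> Gr (R :: 'r::finite itself)" "B \<in> Gr R"
  shows "\<exists>a (b :: 'r \<Rightarrow> real^'m) \<theta>. angle_frame a b \<theta> A B \<and> (\<forall>i. 0 \<le> \<theta> i \<and> \<theta> i \<le> pi / 2)"
proof -
  obtain Y0 Y1 :: "real^'r^'m" where Y: "represents Y0 A" "represents Y1 B"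
    using exists_onb assms represents_family_matrix by metis
  obtain u :: "'r \<Rightarrow> real^'r" and s v where svd: "orthonormal u" "orthonormal v" "\<And>i. 0 \<le> s i"
    "\<And>i. (transpose Y0 ** Y1) *v v i = s i *\<^sub>R u i"
    using exists_svd[of "transpose Y0 ** Y1"] by blast
  have "s i \<le> 1" for i
  proof -
    have "s i = ((transpose Y0 ** Y1) *v v i) \<bullet> u i"
      using svd by (simp add: orthonormalD)
    also have "\<dots> = (Y1 *v v i) \<bullet> (Y0 *v u i)"
      unfolding matrix_vector_mul_assoc[symmetric] transpose_adjoint ..
    also have "\<dots> \<le> norm (Y1 *v v i) * norm (Y0 *v u i)"
      by (rule norm_cauchy_schwarz)
    also have "\<dots> = 1"
      using orthonormal_norm[OF onb_orthonormal[OF represents_image_onb[OF Y(1) svd(1)]]]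
        orthonormal_norm[OF onb_orthonormal[OF represents_image_onb[OF Y(2) svd(2)]]] by simp
    finally show ?thesis .
  qed
  then have s: "cos (arccos (s i)) = s i" "0 \<le> arccos (s i) \<and> arccos (s i) \<le> pi / 2" for i
    using svd(3)[of i] arccos_le_pi2[of "s i"] arccos_lbound[of "s i"] cos_arccos[of "s i"] by auto
  have "angle_frame (\<lambda>i. Y0 *v u i) (\<lambda>i. Y1 *v v i) (\<lambda>i. arccos (s i)) A B"
    using svd by (intro svd_angle_frame Y) (auto simp: s)
  then show ?thesis
    using s by blast
qed

lemma dist_Gr_eq:
  fixes a :: "'r::finite \<Rightarrow> real^'m::finite"
  assumes f: "angle_frame a b \<theta> A B" and \<theta>: "\<And>i. 0 \<le> \<theta> i \<and> \<theta> i \<le> pi / 2"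
  shows "dist_Gr (R :: 'r itself) A B = sqrt (\<Sum>i\<in>UNIV. (\<theta> i)\<^sup>2)"
  unfolding dist_Gr_def principal_angles_eq[OF assms]
  by (simp add: image_mset.compositionality sum_unfold_sum_mset o_def)

text \<open>The left side is the distance of \<open>x\<close> from the nearest multiple of
  pi.\<close>

lemma arccos_abs_cos_le: "arccos \<bar>cos x\<bar> \<le> \<bar>x\<bar>"
proof (cases "\<bar>x\<bar> \<le> pi / 2")
  case True
  then have "cos \<bar>x\<bar> \<ge> 0"
    by (intro cos_ge_zero) auto
  then have "\<bar>cos x\<bar> = cos \<bar>x\<bar>"
    by (simp add: abs_if split: if_splits)
  moreover have "\<bar>x\<bar> \<le> pi"
    using True pi_gt_zero by linarith
  ultimately show ?thesis
    using arccos_cos[of "\<bar>x\<bar>"] by simp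
next
  case False
  have "arccos \<bar>cos x\<bar> \<le> pi / 2"
    by (intro arccos_le_pi2) auto
  with False show ?thesis
    by simp
qed

text \<open>The angles \<open>\<tau>\<close> are arbitrary. Changing the sign of \<open>b i\<close>
  where the cosine is negative folds each of them into [0, pi / 2], which can only shrink its
  absolute value.\<close>

lemma dist_Gr_le:
  fixes a :: "'r::finite \<Rightarrow> real^'m::finite"
  assumes f: "angle_frame a b \<tau> A B"
  shows "dist_Gr (R :: 'r itself) A B \<le> sqrt (\<Sum>i\<in>UNIV. (\<tau> i)\<^sup>2)"
proof -
  define \<epsilon> where "\<epsilon> i = (if cos (\<tau> i) < 0 then - 1 else 1 :: real)" for i
  define b' where "b' i = \<epsilon> i *\<^sub>R b i" for i
  define \<theta> where "\<theta> i = arccos \<bar>cos (\<tau> i)\<bar>" for i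
  have "onb b' B"
  proof (rule onbI_dim)
    show "orthonormal b'"
      using onb_orthonormal[OF angle_frameD(2)[OF f]] by (auto simp: orthonormal_def b'_def \<epsilon>_def)
    show "range b' \<subseteq> B"
      using onb_mem[OF angle_frameD(2)[OF f]] onb_subspace[OF angle_frameD(2)[OF f]]
      by (auto simp: b'_def intro: subspace_scale)
    show "subspace B" "dim B = CARD('r)"
      using angle_frameD(2)[OF f] onb_subspace onb_dim by blast+
  qed
  moreover have "a i \<bullet> b' j = (if i = j then cos (\<theta> i) else 0)" for i j
    by (simp add: b'_def \<epsilon>_def \<theta>_def angle_frameD(3)[OF f] abs_if cos_arccos_abs)
  ultimately have f': "angle_frame a b' \<theta> A B"
    using angle_frameD(1)[OF f] by (simp add: angle_frame_def)
  have \<theta>: "0 \<le> \<theta> i \<and> \<theta> i \<le> pi / 2" for i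
    unfolding \<theta>_def by (intro conjI arccos_lbound arccos_le_pi2) (simp_all add: order_trans[of _ 0])
  have "(\<theta> i)\<^sup>2 \<le> (\<tau> i)\<^sup>2" for i
    using arccos_abs_cos_le[of "\<tau> i"] \<theta>[of i] by (subst abs_le_square_iff[symmetric]) (simp add: \<theta>_def)
  then show ?thesis
    unfolding dist_Gr_eq[OF f' \<theta>] by (intro real_sqrt_le_mono sum_mono)
qed

section \<open>Geodesics, exponential and logarithm\<close>

text \<open>
  The data \<open>a\<close>, \<open>u\<close>, \<open>\<theta>\<close> describe a geodesic issuing from \<open>A\<close>. A direction \<open>u i\<close> with \<open>\<theta> i = 0\<close> is
  irrelevant, and it cannot be required to be orthogonal to \<open>A\<close> when \<open>m < 2 r\<close>.
\<close>

definition geodesic_frame ::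
  "(real^'m::finite) set \<Rightarrow> ('r::finite \<Rightarrow> real^'m) \<Rightarrow> ('r \<Rightarrow> real^'m) \<Rightarrow> ('r \<Rightarrow> real) \<Rightarrow> bool" where
  "geodesic_frame A a u \<theta> \<longleftrightarrow>
     onb a A \<and> orthonormal u \<and> (\<forall>i j. \<theta> i \<noteq> 0 \<longrightarrow> u i \<bullet> a j = 0)"

abbreviation geodesic_family ::
  "('r \<Rightarrow> real^'m) \<Rightarrow> ('r \<Rightarrow> real^'m) \<Rightarrow> ('r \<Rightarrow> real) \<Rightarrow> real \<Rightarrow> 'r \<Rightarrow> real^'m" where
  "geodesic_family a u \<theta> s \<equiv> exp_family a u (\<lambda>i. s * \<theta> i)"

text \<open>Index i rotates in the plane of \<open>a i\<close> and \<open>u i\<close>, and the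
  rotations for different indices stay orthogonal to each other. Where \<open>\<theta> i = 0\<close>
  the factor sin 0 removes \<open>u i\<close>.\<close>

lemma geodesic_family_inner:
  assumes "geodesic_frame A a u \<theta>"
  shows "geodesic_family a u \<theta> s i \<bullet> geodesic_family a u \<theta> s' j
    = (if i = j then cos ((s - s') * \<theta> i) else 0)"
proof -
  have a: "orthonormal a" and u: "orthonormal u" and ua: "\<And>i j. \<theta> i \<noteq> 0 \<Longrightarrow> u i \<bullet> a j = 0"
    using assms by (auto simp: geodesic_frame_def onb_def)
  have "sin (s * \<theta> i) * (u i \<bullet> a j) = 0" "sin (s' * \<theta> j) * (a i \<bullet> u j) = 0"
    using ua[of i j] ua[of j i] by (cases "\<theta> i = 0"; cases "\<theta> j = 0"; simp add: inner_commute)+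
  then show ?thesis
    by (auto simp: exp_family_def inner_add_left inner_add_right orthonormalD[OF a] orthonormalD[OF u]
        left_diff_distrib cos_diff)
qed

lemma geodesic_family_onb:
  assumes "geodesic_frame A a u \<theta>"
  shows "onb (geodesic_family a u \<theta> s) (span (range (geodesic_family a u \<theta> s)))"
  using geodesic_family_inner[OF assms, of s _ s] by (simp add: onb_def orthonormal_def)

lemma geodesic_family_angle_frame:
  assumes "geodesic_frame A a u \<theta>"
  shows "angle_frame (geodesic_family a u \<theta> s) (geodesic_family a u \<theta> s') (\<lambda>i. (s - s') * \<theta> i)
    (span (range (geodesic_family a u \<theta> s))) (span (range (geodesic_family a u \<theta> s')))"
  using geodesic_family_inner[OF assms] geodesic_family_onb[OF assms] by (simp add: angle_frame_def)

lemma geodesic_family_0: "geodesic_family a u \<theta> 0 = a"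
  by (auto simp: exp_family_def)

lemma geodesic_dist_le:
  fixes a :: "'r::finite \<Rightarrow> real^'m::finite"
  assumes "geodesic_frame A a u \<theta>"
  shows "dist_Gr (R :: 'r itself) (span (range (geodesic_family a u \<theta> s)))
    (span (range (geodesic_family a u \<theta> s'))) \<le> \<bar>s - s'\<bar> * sqrt (\<Sum>i\<in>UNIV. (\<theta> i)\<^sup>2)"
  using dist_Gr_le[OF geodesic_family_angle_frame[OF assms, of s s'], of R]
  by (simp add: power_mult_distrib real_sqrt_mult flip: sum_distrib_left)

lemma exists_geodesic_frame:
  fixes A B :: "(real^'m::finite) set"
  assumes "A \<in> Gr (R :: 'r::finite itself)" "B \<in> Gr R"
  shows "\<exists>a (u :: 'r \<Rightarrow> real^'m) \<theta>. geodesic_frame A a u \<theta> \<and>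
    (\<forall>i. 0 \<le> \<theta> i \<and> \<theta> i \<le> pi / 2) \<and> span (range (geodesic_family a u \<theta> 1)) = B"
proof -
  obtain a and b :: "'r \<Rightarrow> real^'m" and \<theta> where f: "angle_frame a b \<theta> A B"
    and \<theta>: "\<And>i. 0 \<le> \<theta> i \<and> \<theta> i \<le> pi / 2"
    using exists_angle_frame[OF assms] by blast
  have a: "orthonormal a" and b: "orthonormal b"
    using f by (auto simp: angle_frame_def onb_def)
  \<comment> \<open>The normalised component of \<open>b i\<close> orthogonal to \<open>A\<close>.
    Where \<open>\<theta> i = 0\<close> there is none, as then \<open>b i = a i\<close>, and
    \<open>orthonormal_extend\<close> picks the direction.\<close>
  define e where "e i = (1 / sin (\<theta> i)) *\<^sub>R (b i - cos (\<theta> i) *\<^sub>R a i)" for i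
  have sin: "sin (\<theta> i) > 0" if "\<theta> i \<noteq> 0" for i
    using \<theta>[of i] that pi_gt_zero by (intro sin_gt_zero) auto
  have ea: "e i \<bullet> a j = 0" for i j
    by (simp add: e_def inner_diff_left angle_frameD(4)[OF f] orthonormalD[OF a])
  have "e i \<bullet> e j = (if i = j then 1 else 0)" if "i \<in> {i. \<theta> i \<noteq> 0}" "j \<in> {i. \<theta> i \<noteq> 0}" for i j
  proof -
    have "e i \<bullet> e j = e i \<bullet> ((1 / sin (\<theta> j)) *\<^sub>R b j)"
      using ea by (simp add: e_def[of j] inner_diff_right)
    also have "\<dots> = (if i = j then (1 - (cos (\<theta> i))\<^sup>2) / (sin (\<theta> i))\<^sup>2 else 0)"
      by (auto simp: e_def inner_diff_left angle_frameD(3)[OF f] orthonormalD[OF b] power2_eq_square)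
    also have "\<dots> = (if i = j then 1 else 0)"
      using sin[of i] that by (auto simp: sin_squared_eq[symmetric])
    finally show ?thesis .
  qed
  moreover have "CARD('r) \<le> DIM(real^'m)"
    using assms(1) dim_subset_UNIV[of A] by (auto simp: Gr_def)
  ultimately obtain u where u: "orthonormal u" "\<forall>i\<in>{i. \<theta> i \<noteq> 0}. u i = e i"
    using orthonormal_extend[of "{i. \<theta> i \<noteq> 0}" e] by blast
  have "geodesic_frame A a u \<theta>"
    using u ea f by (auto simp: geodesic_frame_def angle_frame_def)
  moreover have "geodesic_family a u \<theta> 1 = b"
  proof
    fix i
    show "geodesic_family a u \<theta> 1 i = b i"
    proof (cases "\<theta> i = 0")
      case True
      then have "(b i - a i) \<bullet> (b i - a i) = 0"
        by (simp add: inner_diff_left inner_diff_right angle_frameD(3,4)[OF f]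
            orthonormalD[OF a] orthonormalD[OF b])
      then show ?thesis
        using True by (simp add: exp_family_def)
    next
      case False
      then show ?thesis
        using u(2) sin[of i] by (simp add: exp_family_def e_def)
    qed
  qed
  ultimately show ?thesis
    using \<theta> onb_span[OF angle_frameD(2)[OF f]] by metis
qed

lemma geodesic_family_1_angle_frame:
  assumes "geodesic_frame A a u \<theta>" "span (range (geodesic_family a u \<theta> 1)) = B"
  shows "angle_frame a (geodesic_family a u \<theta> 1) \<theta> A B"
proof -
  have "span (range a) = A"
    using assms(1) by (auto simp: geodesic_frame_def onb_def)
  \<comment> \<open>The parameters 0 and 1 produce the angle -theta; the cosine forgets the
    sign.\<close>
  moreover have "angle_frame a (geodesic_family a u \<theta> 1) (\<lambda>i. - \<theta> i) (span (range a)) B"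
    using geodesic_family_angle_frame[OF assms(1), of 0 1] unfolding assms(2) geodesic_family_0
    by simp
  ultimately show ?thesis
    by (simp add: angle_frame_def)
qed

lemma dist_Gr_geodesic:
  fixes a :: "'r::finite \<Rightarrow> real^'m::finite"
  assumes "geodesic_frame A a u \<theta>" "span (range (geodesic_family a u \<theta> 1)) = B"
    "\<And>i. 0 \<le> \<theta> i \<and> \<theta> i \<le> pi / 2"
  shows "dist_Gr (R :: 'r itself) A B = sqrt (\<Sum>i\<in>UNIV. (\<theta> i)\<^sup>2)"
  by (rule dist_Gr_eq[OF geodesic_family_1_angle_frame]) (use assms in auto)

section \<open>The logarithm and GLERP in principal bases\<close>

lemma matrix_eq_on_basis:
  fixes M N :: "real^'r::finite^'m::finite" and v :: "'r \<Rightarrow> real^'r"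
  assumes "orthonormal v" "\<And>i. M *v v i = N *v v i"
  shows "M = N"
proof -
  have "M *v x = N *v x" for x
  proof -
    have x: "x = (\<Sum>i\<in>UNIV. (x \<bullet> v i) *\<^sub>R v i)"
      by (rule onb_expand[OF orthonormal_onb_UNIV[OF assms(1)] UNIV_I])
    have "L *v x = (\<Sum>i\<in>UNIV. (x \<bullet> v i) *\<^sub>R (L *v v i))" for L :: "real^'r^'m"
      by (subst x) (simp only: linear_sum[OF matrix_vector_mul_linear] matrix_vector_mult_scaleR)
    then show ?thesis
      by (simp add: assms(2))
  qed
  then show ?thesis
    by (simp add: matrix_eq)
qed

lemma matrix_mult_matrix_inv: "invertible M \<Longrightarrow> M ** matrix_inv M = mat 1"
  unfolding invertible_def matrix_inv_def by (rule conjunct1[OF someI_ex])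

text \<open>The matrix Y1 (Y0^T Y1)^(-1) sends \<open>v i\<close> to the vector of \<open>B\<close>
  that projects to \<open>a i\<close> in \<open>A\<close>. This is b_i / cos theta_i = a_i + tan
  theta_i u_i, so subtracting \<open>Y0\<close> leaves singular values tan theta_i, and arctan
  recovers the angles.\<close>

lemma Log_Gr_eq:
  fixes Y0 :: "real^'r::finite^'m::finite"
  assumes fr: "geodesic_frame A a u \<theta>" and B: "span (range (geodesic_family a u \<theta> 1)) = B"
    and \<theta>: "\<And>i. 0 \<le> \<theta> i \<and> \<theta> i < pi / 2" and Y0: "represents Y0 A"
    and v: "orthonormal v" and a: "\<And>i. Y0 *v v i = a i"
  shows "signed_svd (Log_Gr Y0 B) u \<theta> v"
proof -
  define b where "b = geodesic_family a u \<theta> 1"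
  have b_eq: "b i = cos (\<theta> i) *\<^sub>R a i + sin (\<theta> i) *\<^sub>R u i" for i
    by (simp add: b_def exp_family_def)
  have f: "angle_frame a b \<theta> A B"
    using geodesic_family_1_angle_frame[OF fr B] by (simp add: b_def)
  have u: "orthonormal u"
    using fr by (simp add: geodesic_frame_def)
  have v_onb: "onb v UNIV"
    by (rule orthonormal_onb_UNIV[OF v])
  have cos: "cos (\<theta> i) > 0" for i
    using \<theta>[of i] by (intro cos_gt_zero_pi) auto
  have adj: "(transpose Y0 *v x) \<bullet> v i = x \<bullet> a i" for x i
    by (simp only: transpose_adjoint a)
  have coord: "x \<bullet> a i = cos (\<theta> i) * (x \<bullet> b i)" if "x \<in> B" for x i
    using onb_inner[OF angle_frameD(2)[OF f] that, of "a i"]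
    by (simp add: angle_frameD(4)[OF f] if_distrib mult.commute cong: if_cong)
  have svd_tan: "invertible (transpose Y0 ** Y1) \<and>
      signed_svd (Y1 ** matrix_inv (transpose Y0 ** Y1) - Y0) u (\<lambda>i. tan (\<theta> i)) v"
    if Y1: "represents Y1 B" for Y1 :: "real^'r^'m"
  proof
    let ?K = "transpose Y0 ** Y1"
    \<comment> \<open>A vector of \<open>B\<close> orthogonal to \<open>A\<close> vanishes because
      all the cosines are positive.\<close>
    have ker: "x = 0" if "?K *v x = 0" for x
    proof -
      define y where "y = Y1 *v x"
      have y: "y \<in> B"
        using represents_range[OF Y1] by (auto simp: y_def)
      have "transpose Y0 *v y = 0"
        using that by (simp add: y_def matrix_vector_mul_assoc)
      then have "y \<bullet> a i = 0" for i
        using adj[of y i] by simp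
      then have "y \<bullet> b i = 0" for i
        using coord[OF y, of i] cos[of i] by simp
      then have "y = 0"
        using onb_expand[OF angle_frameD(2)[OF f] y] by simp
      then have "x \<bullet> x = 0"
        using represents_inner[OF Y1, of x x] by (simp add: y_def)
      then show ?thesis
        by simp
    qed
    then show inv: "invertible ?K"
      using matrix_left_invertible_ker[of ?K] matrix_left_right_inverse[of _ ?K]
      unfolding invertible_def by blast
    have "(Y1 ** matrix_inv ?K - Y0) *v v i = tan (\<theta> i) *\<^sub>R u i" for i
    proof -
      \<comment> \<open>This vector lies in \<open>B\<close> and projects to \<open>a i\<close>. Its
        coordinates in \<open>b\<close> are then forced, whatever the representative
        \<open>Y1\<close> is.\<close>
      define z where "z = Y1 *v (matrix_inv ?K *v v i)"
      have z: "z \<in> B"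
        using represents_range[OF Y1] by (auto simp: z_def)
      have "transpose Y0 *v z = (?K ** matrix_inv ?K) *v v i"
        by (simp add: z_def matrix_vector_mul_assoc matrix_mul_assoc)
      then have tz: "transpose Y0 *v z = v i"
        using matrix_mult_matrix_inv[OF inv] by simp
      have zb: "z \<bullet> b k = (if i = k then 1 / cos (\<theta> i) else 0)" for k
        using coord[OF z, of k] adj[of z k] cos[of k] unfolding tz
        by (auto simp: orthonormalD[OF v] field_simps split: if_splits)
      have "z = (1 / cos (\<theta> i)) *\<^sub>R b i"
        by (subst onb_expand[OF angle_frameD(2)[OF f] z])
          (simp add: zb if_distrib[of "\<lambda>c. c *\<^sub>R _"] cong: if_cong)
      then have "z = a i + tan (\<theta> i) *\<^sub>R u i"
        using cos[of i] by (simp add: b_eq tan_def scaleR_add_right)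
      then show ?thesis
        by (simp add: matrix_vector_mult_diff_rdistrib a z_def flip: matrix_vector_mul_assoc)
    qed
    then show "signed_svd (Y1 ** matrix_inv ?K - Y0) u (\<lambda>i. tan (\<theta> i)) v"
      using u v by (simp add: signed_svd_def)
  qed
  define \<Delta>0 where "\<Delta>0 = family_matrix u ** diag_mat (\<chi> i. \<theta> i) ** transpose (family_matrix v)"
  have diag_svd: "signed_svd (U ** diag_mat s ** transpose V) (\<lambda>i. column i U) (\<lambda>i. s $ i) (\<lambda>i. column i V)"
    if "orthonormal (\<lambda>i. column i U)" "orthonormal (\<lambda>i. column i V)" for U :: "real^'r^'m" and s V
  proof -
    have "transpose V ** V = mat 1"
      using that(2) by (simp add: transpose_mult_self_iff)
    then have "column i (U ** diag_mat s ** transpose V ** V) = s $ i *\<^sub>R column i U" for i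
      by (simp add: column_mult_diag flip: matrix_mul_assoc)
    then show ?thesis
      using that by (simp add: signed_svd_def flip: column_mult)
  qed
  have svd0: "signed_svd \<Delta>0 u \<theta> v"
    using diag_svd[of "family_matrix u" "family_matrix v" "\<chi> i. \<theta> i"] u v by (simp add: \<Delta>0_def)
  have "Log_Gr Y0 B = \<Delta>0"
    unfolding Log_Gr_def
  proof (rule the_equality)
    define Y1 where "Y1 = family_matrix b"
    have Y1: "represents Y1 B"
      using angle_frameD(2)[OF f] by (simp add: Y1_def represents_family_matrix)
    have "thin_svd (Y1 ** matrix_inv (transpose Y0 ** Y1) - Y0) (family_matrix u)
        (\<chi> i. tan (\<theta> i)) (family_matrix v)"
      using svd_tan[OF Y1] \<theta> by (auto simp: thin_svd_iff signed_svd_def intro!: tan_pos_pi2_le)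
    moreover have "arctan (tan (\<theta> i)) = \<theta> i" for i
      using \<theta>[of i] by (intro arctan_tan) auto
    then have "\<Delta>0 = family_matrix u ** diag_mat (\<chi> i. arctan ((\<chi> i. tan (\<theta> i)) $ i)) **
        transpose (family_matrix v)"
      by (simp add: \<Delta>0_def)
    ultimately show "\<exists>(Y1 :: real^'r^'m) U s V. represents Y1 B \<and> invertible (transpose Y0 ** Y1) \<and>
        thin_svd (Y1 ** matrix_inv (transpose Y0 ** Y1) - Y0) U s V \<and>
        \<Delta>0 = U ** diag_mat (\<chi> i. arctan (s $ i)) ** transpose V"
      using Y1 svd_tan by blast
    fix \<Delta>
    assume "\<exists>(Y1 :: real^'r^'m) U s V. represents Y1 B \<and> invertible (transpose Y0 ** Y1) \<and>
        thin_svd (Y1 ** matrix_inv (transpose Y0 ** Y1) - Y0) U s V \<and>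
        \<Delta> = U ** diag_mat (\<chi> i. arctan (s $ i)) ** transpose V"
    then obtain Y1 :: "real^'r^'m" and U s V where Y1: "represents Y1 B"
      and svd: "thin_svd (Y1 ** matrix_inv (transpose Y0 ** Y1) - Y0) U s V"
      and \<Delta>: "\<Delta> = U ** diag_mat (\<chi> i. arctan (s $ i)) ** transpose V"
      by blast
    have svd\<Delta>: "signed_svd \<Delta> (\<lambda>i. column i U) (\<lambda>i. arctan (s $ i)) (\<lambda>i. column i V)"
      using diag_svd[of U V "\<chi> i. arctan (s $ i)"] svd by (simp add: \<Delta> thin_svd_iff)
    have "\<Delta> *v v j = \<Delta>0 *v v j" for j
    proof -
      \<comment> \<open>Uniqueness of the logarithm: arctan is odd, so \<open>signed_svd_odd\<close>
        carries it from one decomposition to the other.\<close>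
      have "\<theta> j *\<^sub>R u j = arctan (tan (\<theta> j)) *\<^sub>R u j"
        using \<theta>[of j] arctan_tan[of "\<theta> j"] by simp
      also have "\<dots> = (\<Sum>i\<in>UNIV. (v j \<bullet> column i V) *\<^sub>R arctan (s $ i) *\<^sub>R column i U)"
        by (rule signed_svd_odd[where f = arctan and j = j,
              OF thin_svd_signed_svd[OF svd] conjunct2[OF svd_tan[OF Y1]] arctan_minus])
      also have "\<dots> = \<Delta> *v (\<Sum>i\<in>UNIV. (v j \<bullet> column i V) *\<^sub>R column i V)"
        using svd\<Delta> by (simp add: signed_svd_def linear_sum[OF matrix_vector_mul_linear]
            matrix_vector_mult_scaleR)
      also have "(\<Sum>i\<in>UNIV. (v j \<bullet> column i V) *\<^sub>R column i V) = v j"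
        using onb_expand[OF orthonormal_onb_UNIV UNIV_I, of "\<lambda>i. column i V" "v j"] svd
        by (simp add: thin_svd_iff)
      finally show ?thesis
        using svd0 by (simp add: signed_svd_def)
    qed
    then show "\<Delta> = \<Delta>0"
      by (rule matrix_eq_on_basis[OF v])
  qed
  with svd0 show ?thesis
    by simp
qed

lemma represents_preimage:
  fixes Y0 :: "real^'r::finite^'m::finite"
  assumes Y0: "represents Y0 A" and a: "onb a A"
  shows "\<exists>v::'r \<Rightarrow> real^'r. orthonormal v \<and> (\<forall>i. Y0 *v v i = a i)"
proof -
  define v where "v i = transpose Y0 *v a i" for i
  have Yv: "Y0 *v v i = a i" for i
    using represents_projection[OF Y0 onb_mem[OF a]] by (simp add: v_def)
  have "v i \<bullet> v j = a i \<bullet> a j" for i j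
    using represents_inner[OF Y0, of "v i" "v j"] by (simp only: Yv)
  then have "orthonormal v"
    using onb_orthonormal[OF a] by (simp add: orthonormal_def)
  with Yv show ?thesis
    by (intro exI[of _ v] conjI allI)
qed

text \<open>The right side does not mention \<open>Y0\<close>, so \<open>GLERP\<close> does not
  depend on the representative of \<open>A\<close>. Signed decompositions cover negative
  \<open>c\<close>.\<close>

lemma Exp_Log_eq:
  fixes Y0 :: "real^'r::finite^'m::finite" and a :: "'r \<Rightarrow> real^'m"
  assumes fr: "geodesic_frame A a u \<theta>" and B: "span (range (geodesic_family a u \<theta> 1)) = B"
    and \<theta>: "\<And>i. 0 \<le> \<theta> i \<and> \<theta> i < pi / 2" and Y0: "represents Y0 A"
  shows "Exp_Gr Y0 (c *\<^sub>R Log_Gr Y0 B) = span (range (geodesic_family a u \<theta> c))"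
proof -
  obtain v where v: "orthonormal v" "\<And>i. Y0 *v v i = a i"
    using represents_preimage[OF Y0, of a] fr unfolding geodesic_frame_def by auto
  have "signed_svd (c *\<^sub>R Log_Gr Y0 B) u (\<lambda>i. c * \<theta> i) v"
    by (rule signed_svd_scale[OF Log_Gr_eq[OF fr B \<theta> Y0 v]])
  then show ?thesis
    by (simp add: Exp_Gr_eq v(2))
qed

lemma GLERP_eq:
  fixes a :: "'r::finite \<Rightarrow> real^'m::finite"
  assumes fr: "geodesic_frame A a u \<theta>" and B: "span (range (geodesic_family a u \<theta> 1)) = B"
    and \<theta>: "\<And>i. 0 \<le> \<theta> i \<and> \<theta> i < pi / 2"
  shows "GLERP (R :: 'r itself) A B c = span (range (geodesic_family a u \<theta> c))"
  unfolding GLERP_def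
proof (rule the_equality)
  have "represents (family_matrix a) A"
    using fr by (simp add: represents_family_matrix geodesic_frame_def)
  then show "\<exists>Y0 :: real^'r^'m. represents Y0 A \<and>
      span (range (geodesic_family a u \<theta> c)) = Exp_Gr Y0 (c *\<^sub>R Log_Gr Y0 B)"
    using Exp_Log_eq[OF assms] by metis
  show "S = span (range (geodesic_family a u \<theta> c))"
    if "\<exists>Y0 :: real^'r^'m. represents Y0 A \<and> S = Exp_Gr Y0 (c *\<^sub>R Log_Gr Y0 B)" for S
    using that Exp_Log_eq[OF assms] by blast
qed

section \<open>Existence and uniqueness of minimizing geodesics\<close>

lemma trace_signed_svd:
  fixes \<Delta> :: "real^'r::finite^'m::finite"
  assumes "signed_svd \<Delta> u s v"
  shows "trace (transpose \<Delta> ** \<Delta>) = (\<Sum>i\<in>UNIV. (s i)\<^sup>2)"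
proof -
  have v: "onb v UNIV" and u: "orthonormal u" and \<Delta>v: "\<And>i. \<Delta> *v v i = s i *\<^sub>R u i"
    using assms by (auto simp: signed_svd_def orthonormal_onb_UNIV)
  have "trace (transpose \<Delta> ** \<Delta>) = (\<Sum>k\<in>UNIV. (\<Delta> *v axis k 1) \<bullet> (\<Delta> *v axis k 1))"
    by (simp add: trace_def transpose_mult_component matrix_vector_axis)
  also have "\<dots> = (\<Sum>k\<in>UNIV. \<Sum>i\<in>UNIV. (s i)\<^sup>2 * (v i $ k)\<^sup>2)"
  proof (rule sum.cong[OF refl])
    fix k :: 'r
    have "(\<Delta> *v axis k 1) \<bullet> (\<Delta> *v axis k 1)
        = (\<Delta> *v (\<Sum>i\<in>UNIV. (axis k 1 \<bullet> v i) *\<^sub>R v i)) \<bullet> (\<Delta> *v axis k 1)"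
      using onb_expand[OF v UNIV_I, of "axis k 1"] by simp
    also have "\<dots> = (\<Sum>i\<in>UNIV. (axis k 1 \<bullet> v i) * ((\<Delta> *v v i) \<bullet> (\<Delta> *v axis k 1)))"
      by (simp add: linear_sum[OF matrix_vector_mul_linear] matrix_vector_mult_scaleR inner_sum_left)
    also have "\<dots> = (\<Sum>i\<in>UNIV. (s i)\<^sup>2 * (v i $ k)\<^sup>2)"
      by (simp add: signed_svd_inner[OF assms] inner_axis inner_axis' power2_eq_square mult_ac)
    finally show "(\<Delta> *v axis k 1) \<bullet> (\<Delta> *v axis k 1) = (\<Sum>i\<in>UNIV. (s i)\<^sup>2 * (v i $ k)\<^sup>2)" .
  qed
  also have "\<dots> = (\<Sum>i\<in>UNIV. (s i)\<^sup>2 * (v i \<bullet> v i))"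
    by (subst sum.swap) (simp add: inner_vec_def sum_distrib_left power2_eq_square)
  finally show ?thesis
    using v by (simp add: onb_def orthonormalD)
qed

lemma unique_minimizing_geodesicI:
  fixes A B :: "(real^'m::finite) set" and R :: "'r::finite itself"
  assumes AB: "A \<in> Gr R" "B \<in> Gr R" and d: "dist_Gr R A B < pi / 2"
  shows "unique_minimizing_geodesic R A B"
proof -
  have single: "\<theta> i < pi / 2" if "sqrt (\<Sum>i\<in>UNIV. (\<theta> i)\<^sup>2) < pi / 2" for \<theta> :: "'r \<Rightarrow> real" and i
  proof -
    have "(\<theta> i)\<^sup>2 \<le> (\<Sum>i\<in>UNIV. (\<theta> i)\<^sup>2)"
      by (rule member_le_sum) auto
    then have "\<theta> i \<le> sqrt (\<Sum>i\<in>UNIV. (\<theta> i)\<^sup>2)"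
      by (rule real_le_rsqrt)
    with that show ?thesis
      by simp
  qed
  obtain a and u :: "'r \<Rightarrow> real^'m" and \<theta> where fr: "geodesic_frame A a u \<theta>"
    and \<theta>2: "\<And>i. 0 \<le> \<theta> i \<and> \<theta> i \<le> pi / 2" and B: "span (range (geodesic_family a u \<theta> 1)) = B"
    using exists_geodesic_frame[OF AB] by blast
  have dist: "dist_Gr R A B = sqrt (\<Sum>i\<in>UNIV. (\<theta> i)\<^sup>2)"
    by (rule dist_Gr_geodesic[OF fr B \<theta>2])
  have \<theta>: "0 \<le> \<theta> i \<and> \<theta> i < pi / 2" for i
    using \<theta>2[of i] single[of \<theta> i] d dist by simp
  have onb_a: "onb a A"
    using fr by (simp add: geodesic_frame_def)
  define Y where "Y = family_matrix a"
  have Y: "represents Y A"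
    using onb_a by (simp add: Y_def represents_family_matrix)
  obtain v where v: "orthonormal v" "\<And>i. Y *v v i = a i"
    using represents_preimage[OF Y onb_a] by blast
  have svd: "signed_svd (Log_Gr Y B) u \<theta> v"
    by (rule Log_Gr_eq[OF fr B \<theta> Y v])
  have "transpose Y ** Log_Gr Y B = 0"
  proof -
    have "transpose Y *v (Log_Gr Y B *v x) = 0" for x
    proof -
      have "(transpose Y *v (Log_Gr Y B *v x)) \<bullet> v i = 0" for i
      proof -
        have "(Log_Gr Y B *v x) \<bullet> a i
            = (Log_Gr Y B *v (\<Sum>j\<in>UNIV. (x \<bullet> v j) *\<^sub>R v j)) \<bullet> a i"
          using onb_expand[OF orthonormal_onb_UNIV[OF v(1)] UNIV_I, of x] by simp
        also have "\<dots> = (\<Sum>j\<in>UNIV. (x \<bullet> v j) * (\<theta> j * (u j \<bullet> a i)))"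
          using svd by (simp add: signed_svd_def linear_sum[OF matrix_vector_mul_linear]
              matrix_vector_mult_scaleR inner_sum_left mult.assoc)
        also have "\<dots> = 0"
          using fr by (intro sum.neutral) (auto simp: geodesic_frame_def)
        finally show ?thesis
          by (simp only: transpose_adjoint v(2))
      qed
      then show ?thesis
        using onb_expand[OF orthonormal_onb_UNIV[OF v(1)] UNIV_I, of "transpose Y *v (Log_Gr Y B *v x)"]
        by simp
    qed
    then show ?thesis
      by (simp add: matrix_eq flip: matrix_vector_mul_assoc)
  qed
  moreover have "Exp_Gr Y (s *\<^sub>R Log_Gr Y B) = GLERP R A B s" for s
    by (simp add: Exp_Log_eq[OF fr B \<theta> Y] GLERP_eq[OF fr B \<theta>])
  moreover have "GLERP R A B 1 = B"
    using GLERP_eq[OF fr B \<theta>, of R 1] B by simp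
  moreover have "sqrt (trace (transpose (Log_Gr Y B) ** Log_Gr Y B)) = dist_Gr R A B"
    by (simp add: trace_signed_svd[OF svd] dist)
  ultimately have min: "minimizing_geodesic R A B (GLERP R A B)"
    unfolding minimizing_geodesic_def using Y by (intro exI[of _ Y] exI[of _ "Log_Gr Y B"]) simp
  have "\<gamma> s = GLERP R A B s" if \<gamma>: "minimizing_geodesic R A B \<gamma>" and s: "s \<in> {0..1}" for \<gamma> s
  proof -
    obtain Y' \<Delta> :: "real^'r^'m" where Y': "represents Y' A" and tangent: "transpose Y' ** \<Delta> = 0"
      and \<gamma>_eq: "\<And>s. s \<in> {0..1} \<Longrightarrow> \<gamma> s = Exp_Gr Y' (s *\<^sub>R \<Delta>)" and "\<gamma> 1 = B"
      and len: "sqrt (trace (transpose \<Delta> ** \<Delta>)) = dist_Gr R A B"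
      using \<gamma> unfolding minimizing_geodesic_def by blast
    have "CARD('r) \<le> CARD('m)"
      using AB(1) dim_subset_UNIV[of A] by (auto simp: Gr_def)
    then obtain u' \<tau> and v' :: "'r \<Rightarrow> real^'r" where svd_parts: "orthonormal u'" "orthonormal v'" "\<And>i. 0 \<le> \<tau> i"
      "\<And>i. \<Delta> *v v' i = \<tau> i *\<^sub>R u' i"
      using exists_svd[of \<Delta>] by blast
    then have svd': "signed_svd \<Delta> u' \<tau> v'"
      by (simp add: signed_svd_def)
    \<comment> \<open>Minimality enters here: the length of the competitor equals d < pi / 2 and
      bounds each singular value of its velocity. Its own frame therefore satisfies the hypotheses
      of \<open>GLERP_eq\<close>, whose left side knows only \<open>A\<close>, \<open>B\<close> and
      the parameter.\<close>
    have \<tau>: "0 \<le> \<tau> i \<and> \<tau> i < pi / 2" for i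
      using svd_parts(3) single[of \<tau> i] len d trace_signed_svd[OF svd'] by simp
    define a' where "a' i = Y' *v v' i" for i
    have a': "onb a' A"
      unfolding a'_def by (rule represents_image_onb[OF Y' svd_parts(2)])
    have "u' i \<bullet> a' j = 0" if "\<tau> i \<noteq> 0" for i j
    proof -
      have "\<tau> i * (u' i \<bullet> a' j) = (transpose Y' *v (\<Delta> *v v' i)) \<bullet> v' j"
        by (simp only: svd_parts(4) transpose_adjoint a'_def inner_scaleR_left)
      then show ?thesis
        using that tangent by (simp add: matrix_vector_mul_assoc)
    qed
    then have fr': "geodesic_frame A a' u' \<tau>"
      using a' svd_parts(1) by (simp add: geodesic_frame_def)
    have Exp: "Exp_Gr Y' (s *\<^sub>R \<Delta>) = span (range (geodesic_family a' u' \<tau> s))" for s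
      unfolding a'_def by (rule Exp_Gr_eq[OF signed_svd_scale[OF svd']])
    have B': "span (range (geodesic_family a' u' \<tau> 1)) = B"
      using Exp[of 1] \<gamma>_eq[of 1] \<open>\<gamma> 1 = B\<close> by simp
    show ?thesis
      using \<gamma>_eq[OF s] Exp[of s] GLERP_eq[OF fr' B' \<tau>, of R s] by simp
  qed
  with min show ?thesis
    unfolding unique_minimizing_geodesic_def by blast
qed

text \<open>The bound is only an inequality because for large |c| the angles leave [0, pi / 2] and
  fold back.\<close>

lemma GLERP_Gr_dist:
  fixes A B :: "(real^'m::finite) set" and R :: "'r::finite itself"
  assumes AB: "A \<in> Gr R" "B \<in> Gr R" and d: "dist_Gr R A B < pi / 2"
  shows "GLERP R A B c \<in> Gr R" "dist_Gr R A (GLERP R A B c) \<le> \<bar>c\<bar> * dist_Gr R A B"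
proof -
  obtain a and u :: "'r \<Rightarrow> real^'m" and \<theta> where fr: "geodesic_frame A a u \<theta>"
    and \<theta>2: "\<And>i. 0 \<le> \<theta> i \<and> \<theta> i \<le> pi / 2" and B: "span (range (geodesic_family a u \<theta> 1)) = B"
    using exists_geodesic_frame[OF AB] by blast
  have dist: "dist_Gr R A B = sqrt (\<Sum>i\<in>UNIV. (\<theta> i)\<^sup>2)"
    by (rule dist_Gr_geodesic[OF fr B \<theta>2])
  have \<theta>: "0 \<le> \<theta> i \<and> \<theta> i < pi / 2" for i
  proof -
    have "(\<theta> i)\<^sup>2 \<le> (\<Sum>i\<in>UNIV. (\<theta> i)\<^sup>2)"
      by (rule member_le_sum) auto
    then have "\<theta> i \<le> sqrt (\<Sum>i\<in>UNIV. (\<theta> i)\<^sup>2)"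
      by (rule real_le_rsqrt)
    with d dist \<theta>2[of i] show ?thesis
      by simp
  qed
  have eq: "GLERP R A B c = span (range (geodesic_family a u \<theta> c))"
    by (rule GLERP_eq[OF fr B \<theta>])
  show "GLERP R A B c \<in> Gr R"
    unfolding eq by (rule onb_Gr[OF geodesic_family_onb[OF fr]])
  have "A = span (range (geodesic_family a u \<theta> 0))"
    using fr by (simp only: geodesic_family_0) (simp add: geodesic_frame_def onb_def)
  then show "dist_Gr R A (GLERP R A B c) \<le> \<bar>c\<bar> * dist_Gr R A B"
    using geodesic_dist_le[OF fr, of R 0 c] unfolding eq dist by simp
qed

section \<open>Triangle inequality\<close>

text \<open>The sine is concave on [0, pi] and vanishes at 0, so sin x / x decreases.\<close>

lemma sin_star_shaped:
  assumes "0 \<le> x" "x \<le> y" "y \<le> pi"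
  shows "x * sin y \<le> y * sin x"
proof (cases "y = 0")
  case False
  have "convex_on {0..pi} (\<lambda>x. - sin x)"
  proof (rule f''_ge0_imp_convex)
    show "((\<lambda>x. - sin x) has_real_derivative - cos x) (at x)" for x :: real
      by (auto intro!: derivative_eq_intros)
    show "((\<lambda>x. - cos x) has_real_derivative sin x) (at x)" for x :: real
      by (auto intro!: derivative_eq_intros)
  qed (auto intro: sin_ge_zero)
  from convex_onD[OF this, of "x / y" 0 y] have "x / y * sin y \<le> sin x"
    using assms False by (simp add: divide_simps split: if_splits)
  then show ?thesis
    using assms False by (simp add: field_simps)
qed (use assms in auto)

text \<open>The slope of \<open>\<theta>\<^sup>2\<close> as a convex function of \<open>sin\<^sup>2 \<theta>\<close>.\<close>

definition angle_slope :: "real \<Rightarrow> real" where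
  "angle_slope \<theta> = (if \<theta> = 0 then 1 else \<theta> / (sin \<theta> * cos \<theta>))"

text \<open>The tangent-line inequality of the convex function. With g the slope at theta, x^2 - g
  sin^2 x has derivative 2 (x - g sin x cos x), and x / (sin x cos x) = 2 x / sin (2 x) increases,
  so the minimum is at theta.\<close>

lemma angle_slope_tangent:
  assumes "0 \<le> \<theta>" "\<theta> < pi / 2" "0 \<le> \<eta>" "\<eta> < pi / 2"
  shows "\<theta>\<^sup>2 + angle_slope \<theta> * ((sin \<eta>)\<^sup>2 - (sin \<theta>)\<^sup>2) \<le> \<eta>\<^sup>2"
proof (cases "\<theta> = 0")
  case True
  have "\<bar>sin \<eta>\<bar> \<le> \<bar>\<eta>\<bar>"
    by (rule abs_sin_x_le_abs_x)
  then show ?thesis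
    using True by (simp add: angle_slope_def abs_le_square_iff)
next
  case False
  define g where "g = angle_slope \<theta>"
  have pos: "0 < sin \<theta>" "0 < cos \<theta>"
    using assms False by (auto intro: sin_gt_zero cos_gt_zero)
  have cross: "x * (sin y * cos y) \<le> y * (sin x * cos x)" if "0 \<le> x" "x \<le> y" "y \<le> pi / 2" for x y
    using sin_star_shaped[of "2 * x" "2 * y"] that by (simp add: sin_double)
  define k where "k x = x\<^sup>2 - g * (sin x)\<^sup>2" for x
  have deriv: "(k has_real_derivative 2 * x - g * (2 * sin x * cos x)) (at x)" for x
    unfolding k_def by (auto intro!: derivative_eq_intros)
  have "k \<theta> \<le> k \<eta>"
  proof (cases "\<theta> \<le> \<eta>")
    case le: True
    show ?thesis
    proof (rule DERIV_nonneg_imp_nondecreasing[OF le])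
      fix x assume x: "\<theta> \<le> x" "x \<le> \<eta>"
      have "g * (sin x * cos x) \<le> x"
        using cross[of \<theta> x] x assms pos by (simp add: g_def angle_slope_def False divide_simps)
      then show "\<exists>y. (k has_real_derivative y) (at x) \<and> 0 \<le> y"
        using deriv[of x] by (intro exI conjI) auto
    qed
  next
    case False
    then have le: "\<eta> \<le> \<theta>" by simp
    show ?thesis
    proof (rule DERIV_nonpos_imp_nonincreasing[OF le])
      fix x assume x: "\<eta> \<le> x" "x \<le> \<theta>"
      have "x \<le> g * (sin x * cos x)"
        using cross[of x \<theta>] x assms pos \<open>\<theta> \<noteq> 0\<close> by (simp add: g_def angle_slope_def divide_simps)
      then show "\<exists>y. (k has_real_derivative y) (at x) \<and> y \<le> 0"
        using deriv[of x] by (intro exI conjI) auto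
    qed
  qed
  then show ?thesis
    by (simp add: k_def g_def algebra_simps)
qed

text \<open>
  Damping the angles by a factor \<open>c < 1\<close> keeps \<^term>\<open>angle_slope\<close> bounded although it blows up at
  \<open>pi / 2\<close>.
\<close>

definition damped_angle :: "real \<Rightarrow> real \<Rightarrow> real" where
  "damped_angle c \<theta> = arcsin (c * sin \<theta>)"

text \<open>The chain rule gives the factor c^2: the damped angle has squared sine c^2 sin^2 theta,
  and the derivative is taken with respect to sin^2 theta.\<close>

definition damped_slope :: "real \<Rightarrow> real \<Rightarrow> real" where
  "damped_slope c \<theta> = c\<^sup>2 * angle_slope (damped_angle c \<theta>)"

text \<open>For a damped angle t, t / sin t is at most pi / 2 and cos t is at least sqrt (1 -
  c^2).\<close>

definition slope_bound :: "real \<Rightarrow> real" where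
  "slope_bound c = pi / 2 / sqrt (1 - c\<^sup>2)"

context
  fixes c :: real
  assumes c: "0 < c" "c < 1"
begin

lemma sin_damped_angle: "sin (damped_angle c \<theta>) = c * sin \<theta>"
proof -
  have "\<bar>c * sin \<theta>\<bar> \<le> 1"
    using c mult_mono[of c 1 "\<bar>sin \<theta>\<bar>" 1] by (simp add: abs_mult)
  then show ?thesis
    by (simp add: damped_angle_def abs_le_iff)
qed

lemma damped_angle_bounds:
  assumes "0 \<le> \<theta>" "\<theta> \<le> pi / 2"
  shows "0 \<le> damped_angle c \<theta>" "damped_angle c \<theta> < pi / 2" "damped_angle c \<theta> \<le> \<theta>"
proof -
  have s: "0 \<le> sin \<theta>" "sin \<theta> \<le> 1"
    using assms by (auto intro: sin_ge_zero)
  have "c * sin \<theta> \<le> c * 1"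
    using s c by (intro mult_left_mono) auto
  then have "c * sin \<theta> < 1"
    using c by linarith
  moreover have "c * sin \<theta> \<le> 1 * sin \<theta>"
    using s c by (intro mult_right_mono) auto
  ultimately have cs: "0 \<le> c * sin \<theta>" "c * sin \<theta> < 1" "c * sin \<theta> \<le> sin \<theta>"
    using s c by auto
  show "0 \<le> damped_angle c \<theta>"
    using cs arcsin_le_arcsin[of 0 "c * sin \<theta>"] by (simp add: damped_angle_def)
  show "damped_angle c \<theta> < pi / 2"
    using cs arcsin_less_arcsin[of "c * sin \<theta>" 1] by (simp add: damped_angle_def)
  show "damped_angle c \<theta> \<le> \<theta>"
    using cs s assms arcsin_le_arcsin[of "c * sin \<theta>" "sin \<theta>"] arcsin_sin[of \<theta>]
    by (simp add: damped_angle_def)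
qed

lemma damped_slope_tangent:
  assumes "0 \<le> \<theta>" "\<theta> \<le> pi / 2" "0 \<le> \<eta>" "\<eta> \<le> pi / 2"
  shows "(damped_angle c \<theta>)\<^sup>2 + damped_slope c \<theta> * ((sin \<eta>)\<^sup>2 - (sin \<theta>)\<^sup>2) \<le> (damped_angle c \<eta>)\<^sup>2"
  using angle_slope_tangent[of "damped_angle c \<theta>" "damped_angle c \<eta>"] damped_angle_bounds assms
  by (simp add: sin_damped_angle damped_slope_def power_mult_distrib algebra_simps)

lemma cos_damped_angle:
  assumes "0 \<le> \<theta>" "\<theta> \<le> pi / 2"
  shows "sqrt (1 - c\<^sup>2) \<le> cos (damped_angle c \<theta>)" "c * cos \<theta> \<le> cos (damped_angle c \<theta>)"
    "0 < cos (damped_angle c \<theta>)"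
proof -
  show pos: "0 < cos (damped_angle c \<theta>)"
    using damped_angle_bounds[OF assms] by (intro cos_gt_zero_pi) auto
  have sq: "(cos (damped_angle c \<theta>))\<^sup>2 = 1 - c\<^sup>2 * (sin \<theta>)\<^sup>2"
    by (simp add: cos_squared_eq sin_damped_angle power_mult_distrib)
  have "c\<^sup>2 * (sin \<theta>)\<^sup>2 \<le> c\<^sup>2 * 1"
    by (intro mult_left_mono) (auto simp: abs_square_le_1)
  then have "1 - c\<^sup>2 \<le> (cos (damped_angle c \<theta>))\<^sup>2"
    by (simp add: sq)
  then show "sqrt (1 - c\<^sup>2) \<le> cos (damped_angle c \<theta>)"
    using pos by (intro real_le_lsqrt) auto
  have "c\<^sup>2 \<le> 1"
    using c by (simp add: power_le_one)
  then have "(c * cos \<theta>)\<^sup>2 \<le> (cos (damped_angle c \<theta>))\<^sup>2"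
    unfolding sq by (simp add: power_mult_distrib cos_squared_eq right_diff_distrib)
  then show "c * cos \<theta> \<le> cos (damped_angle c \<theta>)"
    by (rule power2_le_imp_le) (use pos in auto)
qed

text \<open>The third bound is the damped form of slope times sin theta cos theta = theta; it
  becomes an inequality through c cos theta <= cos t for the damped angle t. It lets the first-order
  term be measured by the energy itself.\<close>

lemma damped_slope_bounds:
  assumes \<theta>: "0 \<le> \<theta>" "\<theta> \<le> pi / 2"
  shows "0 \<le> damped_slope c \<theta>" "damped_slope c \<theta> \<le> slope_bound c"
    "damped_slope c \<theta> * (sin \<theta> * cos \<theta>) \<le> damped_angle c \<theta>"
proof -
  define t where "t = damped_angle c \<theta>"
  have t: "0 \<le> t" "t < pi / 2"
    using damped_angle_bounds[OF \<theta>] by (auto simp: t_def)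
  have q: "0 < sqrt (1 - c\<^sup>2)" "sqrt (1 - c\<^sup>2) \<le> 1"
    using c by (auto simp: power_less_one_iff abs_square_less_1)
  have st: "0 \<le> sin t"
    using t by (intro sin_ge_zero) auto
  have ct: "0 < cos t" "sqrt (1 - c\<^sup>2) \<le> cos t" "c * cos \<theta> \<le> cos t"
    using cos_damped_angle[OF \<theta>] by (auto simp: t_def)
  have st_pos: "0 < sin t" if "t \<noteq> 0"
    using t that by (intro sin_gt_zero) auto
  have slope0: "0 \<le> angle_slope t"
    using t st ct by (simp add: angle_slope_def)
  then show "0 \<le> damped_slope c \<theta>"
    by (simp add: damped_slope_def t_def)
  have "angle_slope t \<le> slope_bound c"
  proof (cases "t = 0")
    case True
    have "sqrt (1 - c\<^sup>2) \<le> pi / 2"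
      using q pi_ge_two by linarith
    then show ?thesis
      using True q by (simp add: angle_slope_def slope_bound_def divide_simps)
  next
    case False
    have "t \<le> pi / 2 * sin t"
      using sin_star_shaped[of t "pi / 2"] t by simp
    then have "t / sin t \<le> pi / 2"
      using st_pos[OF False] by (simp add: divide_simps)
    then have "t / sin t / cos t \<le> pi / 2 / sqrt (1 - c\<^sup>2)"
      using ct q by (intro frac_le[of "pi / 2"]) auto
    then show ?thesis
      using False by (simp add: angle_slope_def slope_bound_def)
  qed
  moreover have "c\<^sup>2 * angle_slope t \<le> 1 * angle_slope t"
    using c slope0 by (intro mult_right_mono) (auto simp: power_le_one)
  ultimately show "damped_slope c \<theta> \<le> slope_bound c"
    by (simp add: damped_slope_def t_def)
  have "c * sin \<theta> = sin t"
    by (simp add: t_def sin_damped_angle)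
  show "damped_slope c \<theta> * (sin \<theta> * cos \<theta>) \<le> damped_angle c \<theta>"
  proof (cases "t = 0")
    case True
    then have "sin \<theta> = 0"
      using \<open>c * sin \<theta> = sin t\<close> c by simp
    then show ?thesis
      using t by (simp add: t_def)
  next
    case False
    have "damped_slope c \<theta> * (sin \<theta> * cos \<theta>) = angle_slope t * (c * sin \<theta>) * (c * cos \<theta>)"
      by (simp add: damped_slope_def t_def power2_eq_square)
    also have "\<dots> \<le> angle_slope t * (c * sin \<theta>) * cos t"
      using ct slope0 st unfolding \<open>c * sin \<theta> = sin t\<close> by (intro mult_left_mono) auto
    also have "\<dots> = t"
      using st_pos[OF False] ct unfolding \<open>c * sin \<theta> = sin t\<close> by (simp add: angle_slope_def)
    finally show ?thesis
      by (simp add: t_def)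
  qed
qed

end

section \<open>Comparison of the projections to two subspaces\<close>

text \<open>
  Klein's inequality for the convex function whose value at \<open>sin\<^sup>2 \<theta>\<close> is \<open>\<psi> \<theta>\<^sup>2\<close>; the inner sum is a
  diagonal entry, in the basis \<open>a'\<close>, of the projection onto \<open>B\<close>.
\<close>

lemma klein_ineq:
  fixes a b a' c :: "'r::finite \<Rightarrow> real^'m::finite" and \<psi> w :: "real \<Rightarrow> real"
  assumes AB: "angle_frame a b \<alpha> A B" and AC: "angle_frame a' c \<gamma> A C"
    and \<psi>: "\<And>i j. (\<psi> (\<gamma> i))\<^sup>2 + w (\<gamma> i) * ((sin (\<alpha> j))\<^sup>2 - (sin (\<gamma> i))\<^sup>2) \<le> (\<psi> (\<alpha> j))\<^sup>2"
  shows "(\<Sum>i\<in>UNIV. (\<psi> (\<gamma> i))\<^sup>2) \<le> (\<Sum>j\<in>UNIV. (\<psi> (\<alpha> j))\<^sup>2)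
    + (\<Sum>i\<in>UNIV. w (\<gamma> i) * ((\<Sum>j\<in>UNIV. (a' i \<bullet> b j)\<^sup>2) - (cos (\<gamma> i))\<^sup>2))"
proof -
  define p where "p i j = (a' i \<bullet> a j)\<^sup>2" for i j
  have a: "onb a A" and a': "onb a' A"
    using AB AC by (auto simp: angle_frame_def)
  have p1: "(\<Sum>j\<in>UNIV. p i j) = 1" for i
    using onb_parseval[OF a onb_mem[OF a'], of i] orthonormalD[OF onb_orthonormal[OF a'], of i i]
    by (simp add: p_def)
  have N: "(\<Sum>j\<in>UNIV. (a' i \<bullet> b j)\<^sup>2) = (\<Sum>j\<in>UNIV. p i j * (cos (\<alpha> j))\<^sup>2)" for i
    by (simp add: angle_frame_inner[OF AB onb_mem[OF a']] p_def power_mult_distrib mult.commute)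
  \<comment> \<open>The tangent-line inequality at \<open>\<gamma> i\<close> is averaged over the
    \<open>\<alpha> j\<close> with the weights \<open>p i j\<close>, which sum to 1 for each i; in
    the end their sum over i returns each \<open>\<alpha> j\<close> with weight 1.\<close>
  have "(\<Sum>i\<in>UNIV. (\<psi> (\<gamma> i))\<^sup>2 + w (\<gamma> i) * ((cos (\<gamma> i))\<^sup>2 - (\<Sum>j\<in>UNIV. (a' i \<bullet> b j)\<^sup>2)))
      = (\<Sum>i\<in>UNIV. \<Sum>j\<in>UNIV. p i j * ((\<psi> (\<gamma> i))\<^sup>2 + w (\<gamma> i) * ((sin (\<alpha> j))\<^sup>2 - (sin (\<gamma> i))\<^sup>2)))"
  proof (rule sum.cong[OF refl])
    fix i
    have "(\<Sum>j\<in>UNIV. p i j * ((\<psi> (\<gamma> i))\<^sup>2 + w (\<gamma> i) * ((sin (\<alpha> j))\<^sup>2 - (sin (\<gamma> i))\<^sup>2)))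
        = (\<Sum>j\<in>UNIV. p i j * ((\<psi> (\<gamma> i))\<^sup>2 + w (\<gamma> i) * (cos (\<gamma> i))\<^sup>2) - w (\<gamma> i) * (p i j * (cos (\<alpha> j))\<^sup>2))"
      by (intro sum.cong refl) (simp add: sin_squared_eq algebra_simps)
    also have "\<dots> = (\<psi> (\<gamma> i))\<^sup>2 + w (\<gamma> i) * (cos (\<gamma> i))\<^sup>2 - w (\<gamma> i) * (\<Sum>j\<in>UNIV. p i j * (cos (\<alpha> j))\<^sup>2)"
      by (simp add: sum_subtractf p1 flip: sum_distrib_left sum_distrib_right)
    finally show "(\<psi> (\<gamma> i))\<^sup>2 + w (\<gamma> i) * ((cos (\<gamma> i))\<^sup>2 - (\<Sum>j\<in>UNIV. (a' i \<bullet> b j)\<^sup>2))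
        = (\<Sum>j\<in>UNIV. p i j * ((\<psi> (\<gamma> i))\<^sup>2 + w (\<gamma> i) * ((sin (\<alpha> j))\<^sup>2 - (sin (\<gamma> i))\<^sup>2)))"
      by (simp add: N right_diff_distrib)
  qed
  also have "\<dots> \<le> (\<Sum>i\<in>UNIV. \<Sum>j\<in>UNIV. p i j * (\<psi> (\<alpha> j))\<^sup>2)"
    by (intro sum_mono mult_left_mono \<psi>) (simp add: p_def)
  also have "\<dots> = (\<Sum>j\<in>UNIV. \<Sum>i\<in>UNIV. (a j \<bullet> a' i)\<^sup>2 * (\<psi> (\<alpha> j))\<^sup>2)"
    by (subst sum.swap) (simp add: p_def inner_commute)
  also have "\<dots> = (\<Sum>j\<in>UNIV. (\<psi> (\<alpha> j))\<^sup>2)"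
    by (rule onb_double_sum[OF a a', symmetric])
  finally show ?thesis
    by (simp add: sum.distrib right_diff_distrib sum_subtractf)
qed

text \<open>Split a_i = cos gamma_i c_i + e_i with e_i orthogonal to \<open>C\<close> and of norm
  sin gamma_i. In the squared norm of the projection of a_i to \<open>B\<close>, the c_i part is at
  most cos^2 gamma_i and the e_i part at most D^2. The cross term carries cos gamma_i sin gamma_i,
  which \<open>\<rho> i\<close> controls after multiplication by \<open>\<omega> i\<close>;
  Cauchy-Schwarz over i then gives the term linear in D.\<close>

lemma projection_perturbation:
  fixes a c b c' :: "'r::finite \<Rightarrow> real^'m::finite" and \<omega> :: "'r \<Rightarrow> real" and K D :: real
  assumes AC: "angle_frame a c \<gamma> A C" and BC: "angle_frame b c' \<delta> B C"
    and \<gamma>: "\<And>i. 0 \<le> \<gamma> i \<and> \<gamma> i \<le> pi / 2"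
    and \<omega>: "\<And>i. 0 \<le> \<omega> i \<and> \<omega> i \<le> K" and \<rho>: "\<And>i. \<omega> i * (sin (\<gamma> i) * cos (\<gamma> i)) \<le> \<rho> i"
  defines "D \<equiv> sqrt (\<Sum>j\<in>UNIV. (sin (\<delta> j))\<^sup>2)"
  shows "(\<Sum>i\<in>UNIV. \<omega> i * ((\<Sum>j\<in>UNIV. (a i \<bullet> b j)\<^sup>2) - (cos (\<gamma> i))\<^sup>2))
    \<le> 2 * sqrt (\<Sum>i\<in>UNIV. (\<rho> i)\<^sup>2) * D + CARD('r) * K * D\<^sup>2"
proof -
  have a: "orthonormal a" and c: "orthonormal c" and b: "orthonormal b" and c': "orthonormal c'"
    and onb_c: "onb c C" and onb_c': "onb c' C"
    using AC BC by (auto simp: angle_frame_def onb_def)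
  have D2: "D\<^sup>2 = (\<Sum>j\<in>UNIV. (sin (\<delta> j))\<^sup>2)" and D0: "0 \<le> D"
    by (simp_all add: D_def sum_nonneg)
  have cos_nonneg: "0 \<le> cos (\<gamma> i)" and sin_nonneg: "0 \<le> sin (\<gamma> i)" for i
    using \<gamma>[of i] by (auto intro!: cos_ge_zero sin_ge_zero)
  define e where "e i = a i - cos (\<gamma> i) *\<^sub>R c i" for i
  define f where "f j = b j - cos (\<delta> j) *\<^sub>R c' j" for j
  \<comment> \<open>Project \<open>c i\<close> to \<open>B\<close>, then take the part orthogonal to
    \<open>C\<close>. The squared norms sum to at most D^2 over all i, which avoids a dimension
    factor in the linear term.\<close>
  define z where "z i = (\<Sum>j\<in>UNIV. (c i \<bullet> b j) *\<^sub>R f j)" for i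
  have ec: "e i \<bullet> c k = 0" for i k
    by (simp add: e_def inner_diff_left angle_frameD(3)[OF AC] orthonormalD[OF c])
  have eC: "e i \<bullet> x = 0" if "x \<in> C" for i x
    using onb_inner[OF onb_c that, of "e i"] ec[of i] by (simp add: inner_commute)
  have eb: "e i \<bullet> b j = e i \<bullet> f j" for i j
    using eC[OF onb_mem[OF onb_c'], of i j] by (simp add: f_def inner_diff_right)
  have ee: "e i \<bullet> e i = (sin (\<gamma> i))\<^sup>2" for i
  proof -
    have "e i \<bullet> e i = e i \<bullet> a i"
      using ec[of i i] by (subst (2) e_def) (simp add: inner_diff_right)
    also have "\<dots> = 1 - (cos (\<gamma> i))\<^sup>2"
      by (simp add: e_def inner_diff_left angle_frameD(4)[OF AC] orthonormalD[OF a]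
          power2_eq_square)
    also have "\<dots> = (sin (\<gamma> i))\<^sup>2"
      by (simp add: sin_squared_eq)
    finally show ?thesis .
  qed
  have norm_e: "norm (e i) = sin (\<gamma> i)" for i
    using sin_nonneg[of i] by (simp add: norm_eq_sqrt_inner ee)
  have ff: "f j \<bullet> f k = (if j = k then (sin (\<delta> j))\<^sup>2 else 0)" for j k
    by (auto simp: f_def inner_diff_left inner_diff_right angle_frameD(3,4)[OF BC] orthonormalD[OF b]
        orthonormalD[OF c'] power2_eq_square[symmetric] sin_squared_eq)
  have norm_z: "(norm (z i))\<^sup>2 = (\<Sum>j\<in>UNIV. (c i \<bullet> b j)\<^sup>2 * (sin (\<delta> j))\<^sup>2)" for i
    unfolding power2_norm_eq_inner z_def inner_sum_left inner_sum_right
    by (simp add: ff if_distrib power2_eq_square mult_ac cong: if_cong)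
  have "(\<Sum>i\<in>UNIV. (norm (z i))\<^sup>2) = (\<Sum>j\<in>UNIV. (sin (\<delta> j))\<^sup>2 * (\<Sum>i\<in>UNIV. (b j \<bullet> c i)\<^sup>2))"
    unfolding norm_z by (subst sum.swap) (simp add: sum_distrib_left inner_commute mult.commute)
  also have "\<dots> \<le> (\<Sum>j\<in>UNIV. (sin (\<delta> j))\<^sup>2 * 1)"
    using bessel_ineq[OF c, of "b _"] by (intro sum_mono mult_left_mono) (simp_all add: orthonormalD[OF b])
  finally have sum_z: "(\<Sum>i\<in>UNIV. (norm (z i))\<^sup>2) \<le> D\<^sup>2"
    by (simp add: D2)
  have term_bound: "\<omega> i * ((\<Sum>j\<in>UNIV. (a i \<bullet> b j)\<^sup>2) - (cos (\<gamma> i))\<^sup>2) \<le> 2 * (\<bar>\<rho> i\<bar> * \<bar>norm (z i)\<bar>) + K * D\<^sup>2"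
    for i
  proof -
    have ab: "a i \<bullet> b j = cos (\<gamma> i) * (c i \<bullet> b j) + e i \<bullet> b j" for j
      by (simp add: e_def inner_diff_left)
    have "(\<Sum>j\<in>UNIV. (a i \<bullet> b j)\<^sup>2) = (\<Sum>j\<in>UNIV. (cos (\<gamma> i))\<^sup>2 * (c i \<bullet> b j)\<^sup>2
        + 2 * cos (\<gamma> i) * ((c i \<bullet> b j) * (e i \<bullet> f j)) + (e i \<bullet> f j)\<^sup>2)"
      unfolding ab eb by (intro sum.cong refl) (simp add: power2_eq_square algebra_simps)
    also have "\<dots> = (cos (\<gamma> i))\<^sup>2 * (\<Sum>j\<in>UNIV. (c i \<bullet> b j)\<^sup>2) + 2 * cos (\<gamma> i) * (e i \<bullet> z i)
        + (\<Sum>j\<in>UNIV. (e i \<bullet> f j)\<^sup>2)"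
      by (simp add: sum.distrib z_def inner_sum_right flip: sum_distrib_left)
    also have "\<dots> \<le> (cos (\<gamma> i))\<^sup>2 * 1 + 2 * cos (\<gamma> i) * (sin (\<gamma> i) * norm (z i)) + D\<^sup>2"
    proof (intro add_mono mult_left_mono)
      show "(\<Sum>j\<in>UNIV. (c i \<bullet> b j)\<^sup>2) \<le> 1"
        using bessel_ineq[OF b, of "c i"] by (simp add: orthonormalD[OF c])
      show "e i \<bullet> z i \<le> sin (\<gamma> i) * norm (z i)"
        using norm_cauchy_schwarz[of "e i" "z i"] by (simp add: norm_e)
      have "(e i \<bullet> f j)\<^sup>2 \<le> (sin (\<delta> j))\<^sup>2" for j
      proof -
        have "(e i \<bullet> f j)\<^sup>2 \<le> (e i \<bullet> e i) * (f j \<bullet> f j)"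
          by (rule Cauchy_Schwarz_ineq)
        also have "\<dots> \<le> 1 * (sin (\<delta> j))\<^sup>2"
          unfolding ee ff by (intro mult_mono) (auto simp: abs_square_le_1)
        finally show ?thesis
          by simp
      qed
      then show "(\<Sum>j\<in>UNIV. (e i \<bullet> f j)\<^sup>2) \<le> D\<^sup>2"
        unfolding D2 by (rule sum_mono)
    qed (use cos_nonneg[of i] in auto)
    finally have "\<omega> i * ((\<Sum>j\<in>UNIV. (a i \<bullet> b j)\<^sup>2) - (cos (\<gamma> i))\<^sup>2)
        \<le> \<omega> i * (2 * cos (\<gamma> i) * (sin (\<gamma> i) * norm (z i)) + D\<^sup>2)"
      using \<omega>[of i] by (intro mult_left_mono) auto
    also have "\<dots> = 2 * (\<omega> i * (sin (\<gamma> i) * cos (\<gamma> i)) * norm (z i)) + \<omega> i * D\<^sup>2"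
      by (simp add: algebra_simps)
    also have "\<dots> \<le> 2 * (\<bar>\<rho> i\<bar> * \<bar>norm (z i)\<bar>) + K * D\<^sup>2"
      using \<omega>[of i] \<rho>[of i] by (intro add_mono mult_left_mono mult_mono mult_right_mono) auto
    finally show ?thesis .
  qed
  have "(\<Sum>i\<in>UNIV. \<omega> i * ((\<Sum>j\<in>UNIV. (a i \<bullet> b j)\<^sup>2) - (cos (\<gamma> i))\<^sup>2))
      \<le> (\<Sum>i\<in>UNIV. 2 * (\<bar>\<rho> i\<bar> * \<bar>norm (z i)\<bar>) + K * D\<^sup>2)"
    by (intro sum_mono term_bound)
  also have "\<dots> = 2 * (\<Sum>i\<in>UNIV. \<bar>\<rho> i\<bar> * \<bar>norm (z i)\<bar>) + CARD('r) * K * D\<^sup>2"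
    by (simp add: sum.distrib sum_distrib_left)
  also have "(\<Sum>i\<in>UNIV. \<bar>\<rho> i\<bar> * \<bar>norm (z i)\<bar>) \<le> sqrt (\<Sum>i\<in>UNIV. (\<rho> i)\<^sup>2) * D"
  proof -
    have "(\<Sum>i\<in>UNIV. \<bar>\<rho> i\<bar> * \<bar>norm (z i)\<bar>) \<le> L2_set \<rho> UNIV * L2_set (\<lambda>i. norm (z i)) UNIV"
      by (rule L2_set_mult_ineq)
    also have "L2_set (\<lambda>i. norm (z i)) UNIV \<le> D"
      unfolding L2_set_def using sum_z D0 by (intro real_le_lsqrt) (auto simp: sum_nonneg)
    finally show ?thesis
      by (simp add: L2_set_def mult_left_mono sum_nonneg)
  qed
  finally show ?thesis
    by simp
qed

section \<open>From the local estimate to the triangle inequality\<close>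

definition damped_energy ::
  "'r::finite itself \<Rightarrow> real \<Rightarrow> (real^'m) set \<Rightarrow> (real^'m) set \<Rightarrow> real" where
  "damped_energy R c A B = (\<Sum>\<theta>\<in>#principal_angles R A B. (damped_angle c \<theta>)\<^sup>2)"

lemma damped_energy_eq:
  fixes a :: "'r::finite \<Rightarrow> real^'m::finite"
  assumes "angle_frame a b \<theta> A B" "\<And>i. 0 \<le> \<theta> i \<and> \<theta> i \<le> pi / 2"
  shows "damped_energy (R :: 'r itself) c A B = (\<Sum>i\<in>UNIV. (damped_angle c (\<theta> i))\<^sup>2)"
  unfolding damped_energy_def principal_angles_eq[OF assms]
  by (simp add: image_mset.compositionality sum_unfold_sum_mset o_def)

lemma damped_energy_nonneg:
  fixes A B :: "(real^'m::finite) set" and R :: "'r::finite itself"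
  assumes "A \<in> Gr R" "B \<in> Gr R"
  shows "0 \<le> damped_energy R c A B"
proof -
  obtain a and b :: "'r \<Rightarrow> real^'m" and \<theta>
    where "angle_frame a b \<theta> A B" "\<forall>i. 0 \<le> \<theta> i \<and> \<theta> i \<le> pi / 2"
    using exists_angle_frame[OF assms] by blast
  then show ?thesis
    by (simp add: damped_energy_eq sum_nonneg)
qed

lemma dist_Gr_nonneg:
  fixes A B :: "(real^'m::finite) set" and R :: "'r::finite itself"
  assumes "A \<in> Gr R" "B \<in> Gr R"
  shows "0 \<le> dist_Gr R A B"
proof -
  obtain a and b :: "'r \<Rightarrow> real^'m" and \<theta>
    where "angle_frame a b \<theta> A B" "\<forall>i. 0 \<le> \<theta> i \<and> \<theta> i \<le> pi / 2"
    using exists_angle_frame[OF assms] by blast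
  then show ?thesis
    by (simp add: dist_Gr_eq sum_nonneg)
qed

text \<open>The tangent is taken at the angles of \<open>C\<close>, so the unknown energy at
  \<open>C\<close> also appears on the right; \<open>sqrt_local_step\<close> solves for it.\<close>

lemma damped_energy_local:
  fixes A B C :: "(real^'m::finite) set" and R :: "'r::finite itself"
  assumes c: "0 < c" "c < 1" and G: "A \<in> Gr R" "B \<in> Gr R" "C \<in> Gr R"
  defines "d \<equiv> dist_Gr R B C"
  shows "damped_energy R c A C \<le> damped_energy R c A B + 2 * sqrt (damped_energy R c A C) * d
    + CARD('r) * slope_bound c * d\<^sup>2"
proof -
  obtain a and b :: "'r \<Rightarrow> real^'m" and \<alpha> where AB: "angle_frame a b \<alpha> A B"
    and \<alpha>: "\<And>i. 0 \<le> \<alpha> i \<and> \<alpha> i \<le> pi / 2"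
    using exists_angle_frame[OF G(1,2)] by blast
  obtain a' and cc :: "'r \<Rightarrow> real^'m" and \<gamma> where AC: "angle_frame a' cc \<gamma> A C"
    and \<gamma>: "\<And>i. 0 \<le> \<gamma> i \<and> \<gamma> i \<le> pi / 2"
    using exists_angle_frame[OF G(1,3)] by blast
  obtain b' and c' :: "'r \<Rightarrow> real^'m" and \<delta> where BC: "angle_frame b' c' \<delta> B C"
    and \<delta>: "\<And>i. 0 \<le> \<delta> i \<and> \<delta> i \<le> pi / 2"
    using exists_angle_frame[OF G(2,3)] by blast
  define D where "D = sqrt (\<Sum>j\<in>UNIV. (sin (\<delta> j))\<^sup>2)"
  have "0 \<le> D"
    by (simp add: D_def sum_nonneg)
  have "(sin x)\<^sup>2 \<le> x\<^sup>2" for x :: real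
    using abs_sin_x_le_abs_x[of x] by (simp add: abs_le_square_iff)
  then have Dd: "D \<le> d"
    unfolding D_def d_def dist_Gr_eq[OF BC \<delta>] by (intro real_sqrt_le_mono sum_mono)
  \<comment> \<open>The frames for (A, B) and (B, C) use different bases of \<open>B\<close>, but
    only the projection to \<open>B\<close> enters.\<close>
  have "(\<Sum>j\<in>UNIV. (a' i \<bullet> b j)\<^sup>2) = (\<Sum>j\<in>UNIV. (a' i \<bullet> b' j)\<^sup>2)" for i
    using onb_inner_indep[OF angle_frameD(2)[OF AB] angle_frameD(1)[OF BC], of "a' i" "a' i"]
    by (simp add: power2_eq_square)
  moreover have "(\<Sum>i\<in>UNIV. (damped_angle c (\<gamma> i))\<^sup>2) \<le> (\<Sum>j\<in>UNIV. (damped_angle c (\<alpha> j))\<^sup>2)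
      + (\<Sum>i\<in>UNIV. damped_slope c (\<gamma> i) * ((\<Sum>j\<in>UNIV. (a' i \<bullet> b j)\<^sup>2) - (cos (\<gamma> i))\<^sup>2))"
    using \<alpha> \<gamma> by (intro klein_ineq[OF AB AC] damped_slope_tangent[OF c]) auto
  moreover have "(\<Sum>i\<in>UNIV. damped_slope c (\<gamma> i) * ((\<Sum>j\<in>UNIV. (a' i \<bullet> b' j)\<^sup>2) - (cos (\<gamma> i))\<^sup>2))
      \<le> 2 * sqrt (\<Sum>i\<in>UNIV. (damped_angle c (\<gamma> i))\<^sup>2) * D + CARD('r) * slope_bound c * D\<^sup>2"
    unfolding D_def using \<gamma> damped_slope_bounds[OF c]
    by (intro projection_perturbation[OF AC BC]) auto
  ultimately have "damped_energy R c A C \<le> damped_energy R c A B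
      + (2 * sqrt (damped_energy R c A C) * D + CARD('r) * slope_bound c * D\<^sup>2)"
    by (simp add: damped_energy_eq[OF AB \<alpha>] damped_energy_eq[OF AC \<gamma>])
  also have "\<dots> \<le> damped_energy R c A B
      + (2 * sqrt (damped_energy R c A C) * d + CARD('r) * slope_bound c * d\<^sup>2)"
  proof -
    have "0 \<le> slope_bound c"
      using c by (simp add: slope_bound_def power_le_one)
    then show ?thesis
      using Dd \<open>0 \<le> D\<close> damped_energy_nonneg[OF G(1,3), of c]
      by (intro add_left_mono add_mono mult_left_mono power_mono) auto
  qed
  finally show ?thesis
    by simp
qed

text \<open>Completing the square gives (q - d)^2 <= p^2 + (K + 1) d^2 for the two regularised
  roots. As p >= e, the excess is at most 2 p times (K + 1) / (2 e) d^2, so it leaves the root with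
  second order in d; at p = 0 it would cost first order.\<close>

lemma sqrt_local_step:
  fixes x y d e K :: real
  assumes "0 \<le> x" "0 \<le> y" "0 \<le> d" "0 \<le> K" "0 < e" and le: "y \<le> x + 2 * sqrt y * d + K * d\<^sup>2"
  shows "sqrt (y + e\<^sup>2) \<le> sqrt (x + e\<^sup>2) + d + (K + 1) / (2 * e) * d\<^sup>2"
proof -
  define p q where "p = sqrt (x + e\<^sup>2)" and "q = sqrt (y + e\<^sup>2)"
  have p2: "p\<^sup>2 = x + e\<^sup>2" and q2: "q\<^sup>2 = y + e\<^sup>2"
    using assms by (auto simp: p_def q_def)
  have "e \<le> p"
    unfolding p_def using assms by (intro real_le_rsqrt) auto
  have "sqrt y * d \<le> q * d"
    unfolding q_def using assms by (intro mult_right_mono real_sqrt_le_mono) auto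
  then have "(q - d)\<^sup>2 \<le> p\<^sup>2 + (K + 1) * d\<^sup>2"
    using le p2 q2 by (simp add: power2_diff algebra_simps)
  also have "\<dots> \<le> p\<^sup>2 + 2 * p * ((K + 1) / (2 * e) * d\<^sup>2)"
  proof -
    have "(K + 1) * d\<^sup>2 * e \<le> (K + 1) * d\<^sup>2 * p"
      using \<open>e \<le> p\<close> assms by (intro mult_left_mono) auto
    then show ?thesis
      using assms by (simp add: field_simps)
  qed
  also have "\<dots> \<le> (p + (K + 1) / (2 * e) * d\<^sup>2)\<^sup>2"
    by (simp add: power2_sum)
  finally have "q - d \<le> p + (K + 1) / (2 * e) * d\<^sup>2"
    by (rule power2_le_imp_le) (use \<open>e \<le> p\<close> assms in auto)
  then show ?thesis
    by (simp add: p_def q_def)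
qed

text \<open>With N equal pieces the linear terms add up to d and the quadratic ones to L d^2 / N.
  Since L grows like 1 / e, N tends to infinity for fixed e, and only then e tends to 0.\<close>

lemma damped_energy_triangle:
  fixes A B C :: "(real^'m::finite) set" and R :: "'r::finite itself"
  assumes c: "0 < c" "c < 1" and G: "A \<in> Gr R" "B \<in> Gr R" "C \<in> Gr R"
  shows "sqrt (damped_energy R c A C) \<le> sqrt (damped_energy R c A B) + dist_Gr R B C"
proof -
  define d where "d = dist_Gr R B C"
  define F where "F X = damped_energy R c A X" for X
  define K where "K = CARD('r) * slope_bound c"
  have K: "0 \<le> K"
    using c by (simp add: K_def slope_bound_def power_le_one)
  obtain a and u :: "'r \<Rightarrow> real^'m" and \<theta> where fr: "geodesic_frame B a u \<theta>"
    and \<theta>: "\<And>i. 0 \<le> \<theta> i \<and> \<theta> i \<le> pi / 2" and C: "span (range (geodesic_family a u \<theta> 1)) = C"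
    using exists_geodesic_frame[OF G(2,3)] by blast
  have d: "d = sqrt (\<Sum>i\<in>UNIV. (\<theta> i)\<^sup>2)"
    unfolding d_def by (rule dist_Gr_geodesic[OF fr C \<theta>])
  define X where "X s = span (range (geodesic_family a u \<theta> s))" for s
  have X_Gr: "X s \<in> Gr R" for s
    unfolding X_def by (rule onb_Gr[OF geodesic_family_onb[OF fr]])
  have X_dist: "dist_Gr R (X s) (X s') \<le> \<bar>s - s'\<bar> * d" for s s'
    unfolding X_def d by (rule geodesic_dist_le[OF fr])
  have X0: "X 0 = B"
    using fr unfolding X_def geodesic_family_0 by (simp add: geodesic_frame_def onb_def)
  have X1: "X 1 = C"
    using C by (simp add: X_def)
  have "sqrt (F C) \<le> sqrt (F B) + d + e" if e: "0 < e" for e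
  proof -
    define L where "L = (K + 1) / (2 * e)"
    have L: "0 \<le> L"
      using K e by (simp add: L_def)
    define g where "g Z = sqrt (F Z + e\<^sup>2)" for Z
    have step: "g Z \<le> g Y + \<delta> + L * \<delta>\<^sup>2" if "Y \<in> Gr R" "Z \<in> Gr R" "dist_Gr R Y Z \<le> \<delta>" for Y Z \<delta>
    proof -
      have "g Z \<le> g Y + dist_Gr R Y Z + L * (dist_Gr R Y Z)\<^sup>2"
        unfolding g_def L_def F_def
        using damped_energy_local[OF c G(1) that(1,2)] K e damped_energy_nonneg[OF G(1)] that
          dist_Gr_nonneg[OF that(1,2)]
        by (intro sqrt_local_step) (auto simp: K_def)
      also have "\<dots> \<le> g Y + \<delta> + L * \<delta>\<^sup>2"
        using that dist_Gr_nonneg[OF that(1,2)] L by (intro add_mono mult_left_mono power_mono) auto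
      finally show ?thesis .
    qed
    have subdiv: "g C \<le> g B + d + L * d\<^sup>2 / real N" if N: "0 < N" for N
    proof -
      define \<epsilon> where "\<epsilon> = d / real N"
      have "g (X (real k / real N)) \<le> g B + real k * (\<epsilon> + L * \<epsilon>\<^sup>2)" for k
      proof (induction k)
        case (Suc k)
        have "real k / real N - real (Suc k) / real N = - 1 / real N"
          using N by (simp add: field_simps)
        then have "dist_Gr R (X (real k / real N)) (X (real (Suc k) / real N)) \<le> \<epsilon>"
          using X_dist[of "real k / real N" "real (Suc k) / real N"] by (simp add: \<epsilon>_def)
        from step[OF X_Gr X_Gr this] Suc show ?case
          by (simp add: algebra_simps)
      qed (simp add: X0)
      moreover have "real N * (\<epsilon> + L * \<epsilon>\<^sup>2) = d + L * d\<^sup>2 / real N"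
        using N by (simp add: \<epsilon>_def power2_eq_square field_simps)
      ultimately show ?thesis
        using N by (metis X1 add.assoc divide_self_if less_not_refl of_nat_0_eq_iff)
    qed
    have "g C \<le> g B + d"
    proof (rule LIMSEQ_le_const)
      have "(\<lambda>N. g B + d + L * d\<^sup>2 / real N) \<longlonglongrightarrow> g B + d + 0"
        by (intro tendsto_intros lim_const_over_n)
      then show "(\<lambda>N. g B + d + L * d\<^sup>2 / real N) \<longlonglongrightarrow> g B + d"
        by simp
      show "\<exists>N. \<forall>n\<ge>N. g C \<le> g B + d + L * d\<^sup>2 / real n"
        using subdiv by (intro exI[of _ 1]) auto
    qed
    moreover have "sqrt (F C) \<le> g C"
      by (simp add: g_def)
    moreover have "g B \<le> sqrt (F B) + e"
      using sqrt_add_le_add_sqrt[of "F B" "e\<^sup>2"] damped_energy_nonneg[OF G(1,2), of c] e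
      by (simp add: g_def F_def)
    ultimately show ?thesis
      by simp
  qed
  then have "sqrt (F C) \<le> sqrt (F B) + d"
    by (rule field_le_epsilon)
  then show ?thesis
    by (simp add: F_def d_def)
qed

text \<open>Damping lowers angles, so the (A, B) term is bounded by the undamped distance for every
  c < 1. Only the (A, C) term has to be followed as c tends to 1.\<close>

lemma dist_Gr_triangle:
  fixes A B C :: "(real^'m::finite) set" and R :: "'r::finite itself"
  assumes G: "A \<in> Gr R" "B \<in> Gr R" "C \<in> Gr R"
  shows "dist_Gr R A C \<le> dist_Gr R A B + dist_Gr R B C"
proof -
  obtain a and b :: "'r \<Rightarrow> real^'m" and \<alpha> where AB: "angle_frame a b \<alpha> A B"
    and \<alpha>: "\<And>i. 0 \<le> \<alpha> i \<and> \<alpha> i \<le> pi / 2"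
    using exists_angle_frame[OF G(1,2)] by blast
  obtain a' and cc :: "'r \<Rightarrow> real^'m" and \<gamma> where AC: "angle_frame a' cc \<gamma> A C"
    and \<gamma>: "\<And>i. 0 \<le> \<gamma> i \<and> \<gamma> i \<le> pi / 2"
    using exists_angle_frame[OF G(1,3)] by blast
  define s where "s n = real (Suc n) / real (Suc (Suc n))" for n
  have s01: "0 < s n" "s n < 1" for n
    by (auto simp: s_def)
  have s1: "s \<longlonglongrightarrow> 1"
    unfolding s_def by (rule LIMSEQ_Suc[OF LIMSEQ_n_over_Suc_n])
  have le: "sqrt (damped_energy R (s n) A C) \<le> dist_Gr R A B + dist_Gr R B C" for n
  proof -
    have "sqrt (damped_energy R (s n) A B) \<le> dist_Gr R A B"
      unfolding damped_energy_eq[OF AB \<alpha>] dist_Gr_eq[OF AB \<alpha>]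
      using damped_angle_bounds[OF s01] \<alpha> by (intro real_sqrt_le_mono sum_mono power_mono) auto
    with damped_energy_triangle[OF s01 G] show ?thesis
      by (meson add_right_mono order_trans)
  qed
  have lim: "(\<lambda>n. damped_angle (s n) (\<gamma> i)) \<longlonglongrightarrow> \<gamma> i" for i
  proof -
    have sin: "0 \<le> sin (\<gamma> i)" "sin (\<gamma> i) \<le> 1"
      using \<gamma>[of i] by (auto intro: sin_ge_zero)
    \<comment> \<open>Continuity of arcsin on the closed interval suffices, so an angle pi / 2
      causes no trouble here although the slope is infinite there.\<close>
    have "(\<lambda>n. arcsin (s n * sin (\<gamma> i))) \<longlonglongrightarrow> arcsin (1 * sin (\<gamma> i))"
    proof (rule continuous_on_tendsto_compose[of "{-1..1}" arcsin])
      show "continuous_on {-1..1} arcsin"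
        by (rule continuous_on_arcsin')
      show "(\<lambda>n. s n * sin (\<gamma> i)) \<longlonglongrightarrow> 1 * sin (\<gamma> i)"
        by (intro tendsto_intros s1)
      have "0 \<le> s n * sin (\<gamma> i) \<and> s n * sin (\<gamma> i) \<le> 1" for n
        using s01[of n] sin mult_mono[of "s n" 1 "sin (\<gamma> i)" 1] by auto
      then show "\<forall>\<^sub>F n in sequentially. s n * sin (\<gamma> i) \<in> {-1..1}"
        by (intro always_eventually) (auto intro: order_trans[of "- 1" 0])
    qed (use sin in auto)
    then show ?thesis
      using \<gamma>[of i] arcsin_sin[of "\<gamma> i"] by (simp add: damped_angle_def)
  qed
  have "(\<lambda>n. sqrt (damped_energy R (s n) A C)) \<longlonglongrightarrow> dist_Gr R A C"
    unfolding damped_energy_eq[OF AC \<gamma>] dist_Gr_eq[OF AC \<gamma>] by (intro tendsto_intros lim)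
  then show ?thesis
    using le by (intro LIMSEQ_le_const2) auto
qed

section \<open>Intermediate subspaces\<close>

lemma dist_Gr_commute:
  fixes A B :: "(real^'m::finite) set" and R :: "'r::finite itself"
  assumes "A \<in> Gr R" "B \<in> Gr R"
  shows "dist_Gr R A B = dist_Gr R B A"
proof -
  obtain a and b :: "'r \<Rightarrow> real^'m" and \<theta> where f: "angle_frame a b \<theta> A B"
    and \<theta>: "\<And>i. 0 \<le> \<theta> i \<and> \<theta> i \<le> pi / 2"
    using exists_angle_frame[OF assms] by blast
  have "angle_frame b a \<theta> B A"
    using f by (auto simp: angle_frame_def inner_commute)
  then show ?thesis
    by (simp only: dist_Gr_eq[OF _ \<theta>] dist_Gr_eq[OF f \<theta>])
qed

text \<open>The second claim gives \<open>Max\<close> in \<open>max_angle\<close> a nonempty set; it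
  holds because the index type has an element.\<close>

lemma principal_angle_le_dist_Gr:
  fixes A B :: "(real^'m::finite) set" and R :: "'r::finite itself"
  assumes "A \<in> Gr R" "B \<in> Gr R"
  shows "\<forall>\<theta>\<in>#principal_angles R A B. \<theta> \<le> dist_Gr R A B" "principal_angles R A B \<noteq> {#}"
proof -
  obtain a and b :: "'r \<Rightarrow> real^'m" and \<theta> where f: "angle_frame a b \<theta> A B"
    and \<theta>: "\<And>i. 0 \<le> \<theta> i \<and> \<theta> i \<le> pi / 2"
    using exists_angle_frame[OF assms] by blast
  have "\<theta> i \<le> sqrt (\<Sum>i\<in>UNIV. (\<theta> i)\<^sup>2)" for i
    by (intro real_le_rsqrt member_le_sum) auto
  then show "\<forall>\<theta>\<in>#principal_angles R A B. \<theta> \<le> dist_Gr R A B"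
    by (auto simp: principal_angles_eq[OF f \<theta>] dist_Gr_eq[OF f \<theta>])
  show "principal_angles R A B \<noteq> {#}"
    by (simp add: principal_angles_eq[OF f \<theta>] mset_set_empty_iff)
qed

lemma max_angle_le_dist_Gr:
  fixes A B :: "(real^'m::finite) set" and R :: "'r::finite itself"
  assumes "A \<in> Gr R" "B \<in> Gr R"
  shows "max_angle R A B \<le> dist_Gr R A B"
  using principal_angle_le_dist_Gr[OF assms] by (simp add: max_angle_def)

lemma abs_weight_le_weight_bound:
  assumes "k \<in> {1..n}" "j \<in> {0..n - k}" "t \<in> {t0..node t0 h n}"
  shows "\<bar>weight t0 h k j t\<bar> \<le> weight_bound t0 h n"
proof -
  define S where "S k j = (SUP t\<in>{t0..node t0 h n}. \<bar>weight t0 h k j t\<bar>)" for k j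
  have "continuous_on {t0..node t0 h n} (\<lambda>t. \<bar>weight t0 h k j t\<bar>)"
    unfolding weight_def divide_inverse by (intro continuous_intros)
  \<comment> \<open>A real \<open>SUP\<close> bounds the members of its set once the set is bounded
    above; compactness of the interval provides this.\<close>
  then have "bdd_above ((\<lambda>t. \<bar>weight t0 h k j t\<bar>) ` {t0..node t0 h n})"
    by (intro bounded_imp_bdd_above compact_imp_bounded compact_continuous_image) auto
  then have "\<bar>weight t0 h k j t\<bar> \<le> S k j"
    unfolding S_def using assms(3) by (rule cSUP_upper2[OF _ _ order_refl])
  also have "\<dots> \<le> Max (S k ` {0..n - k})"
    using assms(2) by (intro Max_ge) auto
  also have "\<dots> \<le> Max ((\<lambda>k. Max (S k ` {0..n - k})) ` {1..n})"
    using assms(1) by (intro Max_ge) auto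
  finally show ?thesis
    by (simp add: weight_bound_def S_def)
qed

lemma radius_const_nonneg: "0 \<le> A \<Longrightarrow> 0 \<le> L \<Longrightarrow> 0 \<le> radius_const A L k"
  by (induction k) auto

lemma radius_const_mono:
  assumes "0 \<le> A" "0 \<le> L"
  shows "mono (radius_const A L)"
proof (rule incseq_SucI)
  show "radius_const A L k \<le> radius_const A L (Suc k)" for k
    using radius_const_nonneg[OF assms, of k] assms by (simp add: algebra_simps)
qed

theorem proposition4p3:
  fixes Y :: "nat \<Rightarrow> (real^'m::finite) set" and q :: "(real^'m) set"
    and R :: "'r::finite itself" and n :: nat and t0 h A :: real
  defines "\<Lambda> \<equiv> weight_bound t0 h n"
  defines "C \<equiv> radius_const A \<Lambda>"
  defines "I \<equiv> GIDER_sub R t0 h Y"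
  assumes "CARD('r) \<le> CARD('m)"
    and "1 \<le> n"
    and "0 < h"
    and "\<forall>j\<in>{0..n}. Y j \<in> Gr R"
    and "q \<in> Gr R"
    and "Max ((\<lambda>j. dist_Gr R q (Y j)) ` {0..n}) \<le> A * h"
    and "2 * C (n - 1) * h < pi / 2"
  shows
    "(\<forall>t\<in>{t0..node t0 h n}.
        (\<forall>k\<in>{0..n}. \<forall>j\<in>{0..n - k}. I k j t \<in> Gr R \<and> dist_Gr R q (I k j t) \<le> C k * h) \<and>
        (\<forall>k\<in>{1..n}. \<forall>j\<in>{0..n - k}.
           unique_minimizing_geodesic R (I (k - 1) j t) (I (k - 1) (j + 1) t) \<and>
           max_angle R (I (k - 1) j t) (I (k - 1) (j + 1) t)
             \<le> dist_Gr R (I (k - 1) j t) (I (k - 1) (j + 1) t) \<and>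
           dist_Gr R (I (k - 1) j t) (I (k - 1) (j + 1) t) \<le> 2 * C (k - 1) * h \<and>
           2 * C (k - 1) * h \<le> 2 * C (n - 1) * h)) \<and>
     (\<forall>\<eta>. \<eta> < pi / 2 \<and> 2 * C (n - 1) * h \<le> \<eta> \<longrightarrow>
        (\<forall>t\<in>{t0..node t0 h n}. \<forall>k\<in>{1..n}. \<forall>j\<in>{0..n - k}.
           \<forall>\<theta>\<in>#principal_angles R (I (k - 1) j t) (I (k - 1) (j + 1) t).
             \<theta> \<le> \<eta> \<and> pi / 2 - \<eta> \<le> pi / 2 - \<theta>))"
proof -
  note n = \<open>1 \<le> n\<close> and h = \<open>0 < h\<close> and q = \<open>q \<in> Gr R\<close>
    and small = \<open>2 * C (n - 1) * h < pi / 2\<close>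
  have Y: "Y j \<in> Gr R" "dist_Gr R q (Y j) \<le> A * h" if "j \<le> n" for j
    using assms(7,9) that by auto
  have "t0 \<le> node t0 h n"
    using h by (simp add: node_def)
  \<comment> \<open>A single admissible weight, k = 1 and j = 0, already shows that
    \<open>\<Lambda>\<close> is nonnegative.\<close>
  then have "\<bar>weight t0 h 1 0 t0\<bar> \<le> \<Lambda>"
    unfolding \<Lambda>_def using n by (intro abs_weight_le_weight_bound) auto
  then have \<Lambda>: "0 \<le> \<Lambda>"
    by linarith
  have "0 \<le> A * h"
    using Y[of 0] dist_Gr_nonneg[OF q, of "Y 0"] by simp
  then have A: "0 \<le> A"
    using h by (simp add: zero_le_mult_iff)
  have C_le: "2 * C k * h \<le> 2 * C (n - 1) * h" if "k < n" for k
    using monoD[OF radius_const_mono[OF A \<Lambda>], of k "n - 1"] that h by (simp add: C_def)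
  \<comment> \<open>Going through \<open>q\<close> costs two radii. Pairs occur only at levels k <
    n, so smallness at level n - 1, the largest of these radii, covers all of them.\<close>
  have pair: "dist_Gr R X Z \<le> 2 * C k * h \<and> dist_Gr R X Z < pi / 2"
    if "X \<in> Gr R" "Z \<in> Gr R" "dist_Gr R q X \<le> C k * h" "dist_Gr R q Z \<le> C k * h" "k < n" for X Z k
    using dist_Gr_triangle[OF that(1) q that(2)] dist_Gr_commute[OF that(1) q] that(3,4)
      C_le[OF that(5)] small by linarith
  have level: "I k j t \<in> Gr R \<and> dist_Gr R q (I k j t) \<le> C k * h"
    if "t \<in> {t0..node t0 h n}" "k \<le> n" "j \<le> n - k" for k j t
    using that(2,3)
  proof (induction k arbitrary: j)
    case 0
    then show ?case
      using Y by (simp add: I_def C_def)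
  next
    case (Suc k)
    let ?X = "I k j t" and ?Z = "I k (Suc j) t" and ?w = "weight t0 h (Suc k) j t"
    have X: "?X \<in> Gr R" "dist_Gr R q ?X \<le> C k * h" and Z: "?Z \<in> Gr R" "dist_Gr R q ?Z \<le> C k * h"
      using Suc.IH[of j] Suc.IH[of "Suc j"] Suc.prems by auto
    have d: "dist_Gr R ?X ?Z \<le> 2 * C k * h" "dist_Gr R ?X ?Z < pi / 2"
      using pair[OF X(1) Z(1) X(2) Z(2)] Suc.prems by auto
    have I_Suc: "I (Suc k) j t = GLERP R ?X ?Z ?w"
      by (simp add: I_def)
    have G: "I (Suc k) j t \<in> Gr R"
      unfolding I_Suc by (rule GLERP_Gr_dist(1)[OF X(1) Z(1) d(2)])
    have "dist_Gr R ?X (I (Suc k) j t) \<le> \<bar>?w\<bar> * dist_Gr R ?X ?Z"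
      unfolding I_Suc by (rule GLERP_Gr_dist(2)[OF X(1) Z(1) d(2)])
    \<comment> \<open>Origin of the factor 1 + 2 Lambda: one radius from \<open>q\<close> to
      \<open>?X\<close>, then Lambda times a pair distance of two radii.\<close>
    also have "\<dots> \<le> \<Lambda> * (2 * C k * h)"
      unfolding \<Lambda>_def
      using d(1) \<Lambda> dist_Gr_nonneg[OF X(1) Z(1)] Suc.prems that(1)
      by (intro mult_mono abs_weight_le_weight_bound) (auto simp: \<Lambda>_def)
    finally have "dist_Gr R q (I (Suc k) j t) \<le> C k * h + \<Lambda> * (2 * C k * h)"
      using dist_Gr_triangle[OF q X(1) G] X(2) by linarith
    also have "\<dots> = C (Suc k) * h"
      by (simp add: C_def algebra_simps)
    finally show ?case
      using G by blast
  qed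
  have step: "I (k - 1) j t \<in> Gr R" "I (k - 1) (j + 1) t \<in> Gr R"
    "dist_Gr R (I (k - 1) j t) (I (k - 1) (j + 1) t) \<le> 2 * C (k - 1) * h"
    "dist_Gr R (I (k - 1) j t) (I (k - 1) (j + 1) t) < pi / 2"
    if "t \<in> {t0..node t0 h n}" "k \<in> {1..n}" "j \<in> {0..n - k}" for k j t
  proof -
    have "k - 1 \<le> n" "j \<le> n - (k - 1)" "j + 1 \<le> n - (k - 1)"
      using that by auto
    then have X: "I (k - 1) j t \<in> Gr R \<and> dist_Gr R q (I (k - 1) j t) \<le> C (k - 1) * h"
      and Z: "I (k - 1) (j + 1) t \<in> Gr R \<and> dist_Gr R q (I (k - 1) (j + 1) t) \<le> C (k - 1) * h"
      by (simp_all only: level[OF that(1)])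
    then show "I (k - 1) j t \<in> Gr R" "I (k - 1) (j + 1) t \<in> Gr R"
      by auto
    show "dist_Gr R (I (k - 1) j t) (I (k - 1) (j + 1) t) \<le> 2 * C (k - 1) * h"
      "dist_Gr R (I (k - 1) j t) (I (k - 1) (j + 1) t) < pi / 2"
      using pair[of "I (k - 1) j t" "I (k - 1) (j + 1) t" "k - 1"] X Z that(2) by auto
  qed
  have C_step: "2 * C (k - 1) * h \<le> 2 * C (n - 1) * h" if "k \<in> {1..n}" for k
    using C_le[of "k - 1"] that by auto
  have angle: "\<theta> \<le> \<eta>"
    if "2 * C (n - 1) * h \<le> \<eta>" "t \<in> {t0..node t0 h n}" "k \<in> {1..n}" "j \<in> {0..n - k}"
      "\<theta> \<in># principal_angles R (I (k - 1) j t) (I (k - 1) (j + 1) t)" for \<eta> t k j \<theta>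
    using bspec[OF principal_angle_le_dist_Gr(1)[OF step(1,2)[OF that(2-4)]] that(5)]
      step(3)[OF that(2-4)] C_step[OF that(3)] that(1) by linarith
  show ?thesis
  proof (intro conjI ballI allI impI)
    fix t k j
    assume t: "t \<in> {t0..node t0 h n}"
    show "I k j t \<in> Gr R" "dist_Gr R q (I k j t) \<le> C k * h" if "k \<in> {0..n}" "j \<in> {0..n - k}"
      using level[OF t, of k j] that by auto
    assume kj: "k \<in> {1..n}" "j \<in> {0..n - k}"
    show "unique_minimizing_geodesic R (I (k - 1) j t) (I (k - 1) (j + 1) t)"
      by (rule unique_minimizing_geodesicI[OF step(1,2,4)[OF t kj]])
    show "max_angle R (I (k - 1) j t) (I (k - 1) (j + 1) t)
        \<le> dist_Gr R (I (k - 1) j t) (I (k - 1) (j + 1) t)"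
      by (rule max_angle_le_dist_Gr[OF step(1,2)[OF t kj]])
    show "dist_Gr R (I (k - 1) j t) (I (k - 1) (j + 1) t) \<le> 2 * C (k - 1) * h"
      by (rule step(3)[OF t kj])
    show "2 * C (k - 1) * h \<le> 2 * C (n - 1) * h"
      by (rule C_step[OF kj(1)])
    fix \<eta> \<theta>
    assume "\<eta> < pi / 2 \<and> 2 * C (n - 1) * h \<le> \<eta>"
      and \<theta>: "\<theta> \<in># principal_angles R (I (k - 1) j t) (I (k - 1) (j + 1) t)"
    then show "\<theta> \<le> \<eta>" "pi / 2 - \<eta> \<le> pi / 2 - \<theta>"
      using angle[OF _ t kj \<theta>, of \<eta>] by auto
  qed
qed

end
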